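(* Let $\mathcal A$ be a unital $^*$-algebra over $\mathsf C$, let $\boldsymbol{\mathcal A}=(\mathcal A[[\lambda]],\star)$ be a Hermitian deformation of $\mathcal A$, and let $P_0\in M_n(\mathcal A)$ be a strongly full projection. Then every projection $\boldsymbol P\in M_n(\boldsymbol{\mathcal A})$ deforming $P_0$ (i.e. $\boldsymbol P=P_0+O(\lambda)$) is again strongly full, and therefore $\mathrm{End}_{\boldsymbol{\mathcal A}}(\boldsymbol P\star\boldsymbol{\mathcal A}^n)$ and $\boldsymbol{\mathcal A}$ are formally Morita equivalent via the non-degenerate equivalence bimodule $\boldsymbol{\mathcal E}=\boldsymbol P\star\boldsymbol{\mathcal A}^n$.
   Context: $\mathsf R$ is an ordered ring (commutative, associative, unital, with a subset of positive elements closed under sums and products such that $\mathsf R$ is the disjoint union of negatives, $\{0\}$ and positives), with $\mathbb Q\subseteq\mathsf R$, and $\mathsf C=\mathsf R(\mathrm i)$, $\mathrm i^2=-1$. $\mathsf R[[\lambda]]$ is ordered by: $\sum_r a_r\lambda^r>0$ iff the first nonvanishing coefficient is positive; thus all notions below also make sense over $\mathsf C[[\lambda]]=\mathsf R[[\lambda]](\mathrm i)$. A $^*$-algebra over $\mathsf C$ is an associative $\mathsf C$-algebra with an involutive $\mathsf C$-antilinear antiautomorphism $^*$. A linear functional $\omega:\mathcal A\to\mathsf C$ is positive if $\omega(A^*A)\ge0$ for all $A$; $A\in\mathcal A$ is positive ($A\in\mathcal A^+$) if $\omega(A)\ge0$ for all positive $\omega$. A formal deformation of $\mathcal A$ is an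 associative $\mathsf C[[\lambda]]$-bilinear product $\star$ on $\mathcal A[[\lambda]]$, $A\star A'=\sum_{r\ge0}C_r(A,A')\lambda^r$ for $A,A'\in\mathcal A$, with $C_r$ $\mathsf C$-bilinear, $C_0$ the original product and the unit of $\mathcal A$ still a unit; it is Hermitian if $(A\star A')^*=A'^*\star A^*$. $M_n(\boldsymbol{\mathcal A})$ is $M_n(\mathcal A)[[\lambda]]$ with the matrix product built from $\star$. Matrix algebras carry the involution $(L^* )_{ij}=(L_{ji})^*$, and a projection is a Hermitian idempotent. A projection $P_0\in M_n(\mathcal A)$ over a unital $^*$-algebra is strongly full if there is an invertible $\tau\in\mathcal A$ with $\mathrm{tr}\,P_0=(\tau\tau^* )^{-1}$, where $\mathrm{tr}\,P_0=\sum_i(P_0)_{ii}$ (for $\boldsymbol{\mathcal A}$, the same with product $\star$). Equivalence bimodules. Let $\mathcal A,\mathcal B$ be unital $^*$-algebras over $\mathsf C$. An equivalence bimodule is a $(\mathcal B$-$\mathcal A)$-bimodule $\mathcal E$ with an $\mathcal A$-valued inner product $\langle\cdot,\cdot\rangle$ (sesquilinear, linear and $\mathcal A$-right linear in the second argument, $\langle x,y\rangle^*=\langle y,x\rangle$, $\langle x,x\rangle\in\mathcal A^+$) and a $\mathcal B$-valued inner product $\Theta_{\cdot,\cdot}$ (sesquilinear, linear and $\mathcal B$-left linear in the first argument, $\Theta_{x,y}^*=\Theta_{y,x}$, $\Theta_{x,x}\in\mathcal B^+$), both full (the spans of $\langle\mathcal E,\mathcal E\rangle$ and $\Theta_{\mathcal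 E,\mathcal E}$ are $\mathcal A$ and $\mathcal B$), such that $\langle x,By\rangle=\langle B^*x,y\rangle$, $\Theta_{x,yA}=\Theta_{xA^*,y}$, $\Theta_{x,y}z=x\langle y,z\rangle$, and satisfying (P) and (Q). (P): for every $^*$-representation $\pi$ of $\mathcal A$ on a pre-Hilbert space $\mathfrak H$ over $\mathsf C$ (a $\mathsf C$-module with positive definite Hermitian inner product), the inner product on $\mathcal E\otimes_{\mathcal A}\mathfrak H$ given by $\langle x\otimes\psi,y\otimes\phi\rangle=\langle\psi,\pi(\langle x,y\rangle)\phi\rangle$ is positive semi-definite. (Q): the analogous property for $^*$-representations of $\mathcal B$ and the complex-conjugate bimodule $\overline{\mathcal E}$, i.e. $\langle\overline x\otimes\psi,\overline y\otimes\phi\rangle=\langle\psi,\pi(\Theta_{x,y})\phi\rangle$ is positive semi-definite on $\overline{\mathcal E}\otimes_{\mathcal B}\mathfrak H$ for all $^*$-representations $(\pi,\mathfrak H)$ of $\mathcal B$. $\mathcal E$ is non-degenerate if both actions are non-degenerate (for unital algebras: the units act as the identity). $\mathcal A$ and $\mathcal B$ are formally Morita equivalent if an equivalence bimodule exists. Here $\boldsymbol P\star\boldsymbol{\mathcal A}^n$ is regarded as an $(\mathrm{End}_{\boldsymbol{\mathcal A}}(\boldsymbol P\star\boldsymbol{\mathcal A}^n)$-$\boldsymbol{\mathcal A})$-bimodule, where $\mathrm{End}_{\boldsymbol{\mathcal A}}(\boldsymbol P\star\boldsymbol{\mathcal A}^n)=\boldsymbol P\star M_n(\boldsymbol{\mathcal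 A})\star\boldsymbol P$ as $^*$-algebras, with $\langle x,y\rangle=\sum_i x_i^*\star y_i$ and $\Theta_{x,y}z=x\star\langle y,z\rangle$. *)

theory Defs
  imports
    "HOL-Computational_Algebra.Formal_Power_Series"
    "HOL-Algebra.Free_Abelian_Groups"
    "HOL-Algebra.Algebraic_Closure_Type"
begin

section \<open>Ordered rings, formal power series, complex numbers\<close>

text \<open>
  The class \<^class>\<open>linordered_idom\<close> captures ordered rings: if the ring is the disjoint
  union of negatives, zero and positives, and the positives are closed under sums and products,
  then there are no zero divisors.
\<close>

definition contains_rationals :: "'r::linordered_idom itself \<Rightarrow> bool" where
  "contains_rationals _ \<longleftrightarrow>
     (\<exists>h :: rat \<Rightarrow> 'r. inj h \<and> h 1 = 1 \<and>
        (\<forall>p q. h (p + q) = h p + h q) \<and> (\<forall>p q. h (p * q) = h p * h q))"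

text \<open>A formal power series is positive iff its first nonvanishing coefficient is positive.\<close>

definition fps_pos :: "'r::linordered_idom fps \<Rightarrow> bool" where
  "fps_pos f \<longleftrightarrow> f \<noteq> 0 \<and> f $ subdegree f > 0"

lemma fps_pos_add:
  assumes "fps_pos f" "fps_pos g"
  shows "fps_pos (f + g)"
proof -
  have f: "f $ subdegree f > 0" and g: "g $ subdegree g > 0"
    using assms by (auto simp: fps_pos_def)
  define n where "n = min (subdegree f) (subdegree g)"
  have lo: "(f + g) $ k = 0" if "k < n" for k
    using that by (simp add: n_def nth_less_subdegree_zero)
  have "f $ n \<ge> 0" "g $ n \<ge> 0" "f $ n > 0 \<or> g $ n > 0"
    using f g nth_less_subdegree_zero[of n f] nth_less_subdegree_zero[of n g]
    by (cases "subdegree f" "subdegree g" rule: linorder_cases; simp add: n_def)+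
  then have pos: "(f + g) $ n > 0"
    by (auto simp: add_pos_nonneg add_nonneg_pos)
  then have n: "subdegree (f + g) = n"
    using lo by (intro subdegreeI) auto
  have "f + g \<noteq> 0"
    using pos by (metis fps_zero_nth less_irrefl)
  then show ?thesis
    using pos n by (simp add: fps_pos_def)
qed

lemma fps_pos_mult: "fps_pos f \<Longrightarrow> fps_pos g \<Longrightarrow> fps_pos (f * g)"
  by (auto simp: fps_pos_def)

lemma fps_pos_cases: "f = 0 \<or> fps_pos f \<or> fps_pos (- f)"
  using nth_subdegree_nonzero[of f] linorder_less_linear[of "f $ subdegree f" 0]
  by (auto simp: fps_pos_def)

lemma fps_pos_uminus: "fps_pos f \<Longrightarrow> \<not> fps_pos (- f)"
  unfolding fps_pos_def by auto

instantiation fps :: (linordered_idom) linordered_idom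
begin

definition "f < g \<longleftrightarrow> fps_pos (g - f)"
definition "f \<le> g \<longleftrightarrow> f = g \<or> fps_pos (g - f)"
definition "\<bar>f :: 'a fps\<bar> = (if f < 0 then - f else f)"
definition "sgn (f :: 'a fps) = (if f = 0 then 0 else if 0 < f then 1 else - 1)"

instance
proof
  fix f g h :: "'a fps"
  show "f < g \<longleftrightarrow> f \<le> g \<and> \<not> g \<le> f"
    using fps_pos_uminus[of "g - f"] by (auto simp: less_fps_def less_eq_fps_def fps_pos_def)
  show "f \<le> f"
    by (simp add: less_eq_fps_def)
  show "f \<le> g \<Longrightarrow> g \<le> h \<Longrightarrow> f \<le> h"
    using fps_pos_add[of "g - f" "h - g"] by (auto simp: less_eq_fps_def)
  show "f \<le> g \<Longrightarrow> g \<le> f \<Longrightarrow> f = g"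
    using fps_pos_uminus[of "g - f"] by (auto simp: less_eq_fps_def)
  show "f \<le> g \<Longrightarrow> h + f \<le> h + g"
    by (auto simp: less_eq_fps_def)
  show "f \<le> g \<or> g \<le> f"
    using fps_pos_cases[of "g - f"] by (auto simp: less_eq_fps_def)
  show "f < g \<Longrightarrow> 0 < h \<Longrightarrow> h * f < h * g"
    using fps_pos_mult[of h "g - f"] by (auto simp: less_fps_def algebra_simps)
  show "\<bar>f\<bar> = (if f < 0 then - f else f)"
    by (simp add: abs_fps_def)
  show "sgn f = (if f = 0 then 0 else if 0 < f then 1 else - 1)"
    by (simp add: sgn_fps_def)
qed

end

text \<open>The ring \<open>R(i)\<close> over an ordered ring \<open>R\<close>.\<close>

datatype 'r cx = Cx (cx_re: 'r) (cx_im: 'r)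

instantiation cx :: (linordered_idom) comm_ring_1
begin

definition "0 = Cx 0 0"
definition "1 = Cx 1 0"
definition "z + w = Cx (cx_re z + cx_re w) (cx_im z + cx_im w)"
definition "- z = Cx (- cx_re z) (- cx_im z)"
definition "z - w = Cx (cx_re z - cx_re w) (cx_im z - cx_im w)"
definition "z * w = Cx (cx_re z * cx_re w - cx_im z * cx_im w)
                       (cx_re z * cx_im w + cx_im z * cx_re w)"

instance
  by standard (auto simp: zero_cx_def one_cx_def plus_cx_def uminus_cx_def minus_cx_def
    times_cx_def algebra_simps intro!: cx.expand)

end

definition cx_cnj :: "'r::linordered_idom cx \<Rightarrow> 'r cx" where
  "cx_cnj z = Cx (cx_re z) (- cx_im z)"

definition cx_nonneg :: "'r::linordered_idom cx \<Rightarrow> bool" where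
  "cx_nonneg z \<longleftrightarrow> cx_im z = 0 \<and> cx_re z \<ge> 0"

text \<open>Coefficients under the identification of \<open>R[[\<lambda>]](i)\<close> with \<open>C[[\<lambda>]]\<close>.\<close>

definition cx_fps_nth :: "'r::linordered_idom fps cx \<Rightarrow> nat \<Rightarrow> 'r cx" where
  "cx_fps_nth z k = Cx (cx_re z $ k) (cx_im z $ k)"

text \<open>The scalar ring, as a record as required by the locale \<^locale>\<open>module\<close>.\<close>

abbreviation scalars :: "'r::linordered_idom cx ring" where
  "scalars \<equiv> ring_of_type_algebra"


section \<open>Star algebras, positivity, representations\<close>

record ('c, 'a) star_alg = "('c, 'a) module" +
  star :: "'a \<Rightarrow> 'a"

locale star_algebra = ring A + module scalars A
  for A :: "('r::linordered_idom cx, 'a, 'm) star_alg_scheme" (structure) +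
  assumes smult_mult_left: "x \<in> carrier A \<Longrightarrow> y \<in> carrier A \<Longrightarrow> (c \<odot> x) \<otimes> y = c \<odot> (x \<otimes> y)"
    and smult_mult_right: "x \<in> carrier A \<Longrightarrow> y \<in> carrier A \<Longrightarrow> x \<otimes> (c \<odot> y) = c \<odot> (x \<otimes> y)"
    and star_closed: "x \<in> carrier A \<Longrightarrow> star A x \<in> carrier A"
    and star_star: "x \<in> carrier A \<Longrightarrow> star A (star A x) = x"
    and star_add: "x \<in> carrier A \<Longrightarrow> y \<in> carrier A \<Longrightarrow> star A (x \<oplus> y) = star A x \<oplus> star A y"
    and star_smult: "x \<in> carrier A \<Longrightarrow> star A (c \<odot> x) = cx_cnj c \<odot> star A x"
    and star_mult: "x \<in> carrier A \<Longrightarrow> y \<in> carrier A \<Longrightarrow> star A (x \<otimes> y) = star A y \<otimes> star A x"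

definition star_iso ::
  "('c, 'a, 'm) star_alg_scheme \<Rightarrow> ('c, 'b, 'k) star_alg_scheme \<Rightarrow> ('a \<Rightarrow> 'b) \<Rightarrow> bool" where
  "star_iso A B h \<longleftrightarrow> h \<in> ring_iso A B \<and>
     (\<forall>c. \<forall>a\<in>carrier A. h (c \<odot>\<^bsub>A\<^esub> a) = c \<odot>\<^bsub>B\<^esub> h a) \<and>
     (\<forall>a\<in>carrier A. h (star A a) = star B (h a))"

definition positive_functional ::
  "('r::linordered_idom cx, 'a, 'm) star_alg_scheme \<Rightarrow> ('a \<Rightarrow> 'r cx) \<Rightarrow> bool" where
  "positive_functional A \<omega> \<longleftrightarrow>
     (\<forall>a\<in>carrier A. \<forall>b\<in>carrier A. \<omega> (a \<oplus>\<^bsub>A\<^esub> b) = \<omega> a + \<omega> b) \<and>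
     (\<forall>c. \<forall>a\<in>carrier A. \<omega> (c \<odot>\<^bsub>A\<^esub> a) = c * \<omega> a) \<and>
     (\<forall>a\<in>carrier A. cx_nonneg (\<omega> (star A a \<otimes>\<^bsub>A\<^esub> a)))"

definition positive_elements ::
  "('r::linordered_idom cx, 'a, 'm) star_alg_scheme \<Rightarrow> 'a set" where
  "positive_elements A =
     {a \<in> carrier A. \<forall>\<omega>. positive_functional A \<omega> \<longrightarrow> cx_nonneg (\<omega> a)}"

text \<open>
  Modules that are not algebras also use the library record \<open>module\<close>; its fields \<open>mult\<close> and
  \<open>one\<close> are irrelevant for them.
\<close>

record ('c, 'h) prehilbert = "('c, 'h) module" +
  ip :: "'h \<Rightarrow> 'h \<Rightarrow> 'c"

locale pre_hilbert_space = module scalars H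
  for H :: "('r::linordered_idom cx, 'h, 'm) prehilbert_scheme" (structure) +
  assumes ip_add: "x \<in> carrier H \<Longrightarrow> y \<in> carrier H \<Longrightarrow> z \<in> carrier H \<Longrightarrow>
            ip H x (y \<oplus> z) = ip H x y + ip H x z"
    and ip_smult: "x \<in> carrier H \<Longrightarrow> y \<in> carrier H \<Longrightarrow> ip H x (c \<odot> y) = c * ip H x y"
    and ip_hermitian: "x \<in> carrier H \<Longrightarrow> y \<in> carrier H \<Longrightarrow> ip H x y = cx_cnj (ip H y x)"
    and ip_nonneg: "x \<in> carrier H \<Longrightarrow> cx_nonneg (ip H x x)"
    and ip_definite: "x \<in> carrier H \<Longrightarrow> ip H x x = 0 \<Longrightarrow> x = \<zero>"

text \<open>Representations of unital algebras are not required to preserve the unit.\<close>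

definition star_representation ::
  "('r::linordered_idom cx, 'a, 'm) star_alg_scheme \<Rightarrow>
   ('r cx, 'h, 'k) prehilbert_scheme \<Rightarrow> ('a \<Rightarrow> 'h \<Rightarrow> 'h) \<Rightarrow> bool" where
  "star_representation A H \<pi> \<longleftrightarrow>
     (\<forall>a\<in>carrier A. \<forall>x\<in>carrier H. \<pi> a x \<in> carrier H) \<and>
     (\<forall>a\<in>carrier A. \<forall>x\<in>carrier H. \<forall>y\<in>carrier H. \<pi> a (x \<oplus>\<^bsub>H\<^esub> y) = \<pi> a x \<oplus>\<^bsub>H\<^esub> \<pi> a y) \<and>
     (\<forall>a\<in>carrier A. \<forall>c. \<forall>x\<in>carrier H. \<pi> a (c \<odot>\<^bsub>H\<^esub> x) = c \<odot>\<^bsub>H\<^esub> \<pi> a x) \<and>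
     (\<forall>a\<in>carrier A. \<forall>b\<in>carrier A. \<forall>x\<in>carrier H. \<pi> (a \<oplus>\<^bsub>A\<^esub> b) x = \<pi> a x \<oplus>\<^bsub>H\<^esub> \<pi> b x) \<and>
     (\<forall>c. \<forall>a\<in>carrier A. \<forall>x\<in>carrier H. \<pi> (c \<odot>\<^bsub>A\<^esub> a) x = c \<odot>\<^bsub>H\<^esub> \<pi> a x) \<and>
     (\<forall>a\<in>carrier A. \<forall>b\<in>carrier A. \<forall>x\<in>carrier H. \<pi> (a \<otimes>\<^bsub>A\<^esub> b) x = \<pi> a (\<pi> b x)) \<and>
     (\<forall>a\<in>carrier A. \<forall>x\<in>carrier H. \<forall>y\<in>carrier H.
        ip H x (\<pi> a y) = ip H (\<pi> (star A a) x) y)"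


section \<open>Bimodules with inner products and the internal tensor product\<close>

record ('c, 'a, 'e) inner_module = "('c, 'e) module" +
  ract :: "'e \<Rightarrow> 'a \<Rightarrow> 'e"
  rip :: "'e \<Rightarrow> 'e \<Rightarrow> 'a"

record ('c, 'b, 'a, 'e) inner_bimodule = "('c, 'a, 'e) inner_module" +
  lact :: "'b \<Rightarrow> 'e \<Rightarrow> 'e"
  lip :: "'e \<Rightarrow> 'e \<Rightarrow> 'b"

text \<open>
  The abelian group \<open>E \<otimes>\<^sub>A H\<close>: the free abelian group on \<open>E \<times> H\<close> modulo the relations of
  biadditivity, \<open>C\<close>-balancedness and \<open>A\<close>-balancedness.
\<close>

definition tensor_relations ::
  "('c, 'a, 'm) star_alg_scheme \<Rightarrow> ('c, 'a, 'e, 'k) inner_module_scheme \<Rightarrow>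
   ('c, 'h, 'l) prehilbert_scheme \<Rightarrow> ('a \<Rightarrow> 'h \<Rightarrow> 'h) \<Rightarrow> ('e \<times> 'h \<Rightarrow>\<^sub>0 int) set" where
  "tensor_relations A E H \<pi> =
     {frag_of (x \<oplus>\<^bsub>E\<^esub> y, \<psi>) - frag_of (x, \<psi>) - frag_of (y, \<psi>) | x y \<psi>.
        x \<in> carrier E \<and> y \<in> carrier E \<and> \<psi> \<in> carrier H} \<union>
     {frag_of (x, \<psi> \<oplus>\<^bsub>H\<^esub> \<phi>) - frag_of (x, \<psi>) - frag_of (x, \<phi>) | x \<psi> \<phi>.
        x \<in> carrier E \<and> \<psi> \<in> carrier H \<and> \<phi> \<in> carrier H} \<union>
     {frag_of (c \<odot>\<^bsub>E\<^esub> x, \<psi>) - frag_of (x, c \<odot>\<^bsub>H\<^esub> \<psi>) | c x \<psi>.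
        x \<in> carrier E \<and> \<psi> \<in> carrier H} \<union>
     {frag_of (ract E x a, \<psi>) - frag_of (x, \<pi> a \<psi>) | x a \<psi>.
        x \<in> carrier E \<and> a \<in> carrier A \<and> \<psi> \<in> carrier H}"

definition tensor_product ::
  "('c, 'a, 'm) star_alg_scheme \<Rightarrow> ('c, 'a, 'e, 'k) inner_module_scheme \<Rightarrow>
   ('c, 'h, 'l) prehilbert_scheme \<Rightarrow> ('a \<Rightarrow> 'h \<Rightarrow> 'h) \<Rightarrow> ('e \<times> 'h \<Rightarrow>\<^sub>0 int) set monoid" where
  "tensor_product A E H \<pi> =
     free_Abelian_group (carrier E \<times> carrier H) Mod
     generate (free_Abelian_group (carrier E \<times> carrier H)) (tensor_relations A E H \<pi>)"

text \<open>
  The biadditive extension of \<open>\<langle>x \<otimes> \<psi>, y \<otimes> \<phi>\<rangle> = \<langle>\<psi>, \<pi>(\<langle>x, y\<rangle>) \<phi>\<rangle>\<close>, first on the free abelian group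
  and then on the tensor product (as the common value on all representatives).
\<close>

definition tensor_form_frag ::
  "('c::comm_ring_1, 'a, 'e, 'k) inner_module_scheme \<Rightarrow> ('c, 'h, 'l) prehilbert_scheme \<Rightarrow>
   ('a \<Rightarrow> 'h \<Rightarrow> 'h) \<Rightarrow> ('e \<times> 'h \<Rightarrow>\<^sub>0 int) \<Rightarrow> ('e \<times> 'h \<Rightarrow>\<^sub>0 int) \<Rightarrow> 'c" where
  "tensor_form_frag E H \<pi> u v =
     (\<Sum>(x, \<psi>)\<in>Poly_Mapping.keys u. \<Sum>(y, \<phi>)\<in>Poly_Mapping.keys v.
        of_int (Poly_Mapping.lookup u (x, \<psi>)) * of_int (Poly_Mapping.lookup v (y, \<phi>)) *
        ip H \<psi> (\<pi> (rip E x y) \<phi>))"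

definition tensor_form ::
  "('c::comm_ring_1, 'a, 'e, 'k) inner_module_scheme \<Rightarrow> ('c, 'h, 'l) prehilbert_scheme \<Rightarrow>
   ('a \<Rightarrow> 'h \<Rightarrow> 'h) \<Rightarrow> ('e \<times> 'h \<Rightarrow>\<^sub>0 int) set \<Rightarrow> ('e \<times> 'h \<Rightarrow>\<^sub>0 int) set \<Rightarrow> 'c" where
  "tensor_form E H \<pi> U V = (THE c. \<forall>u\<in>U. \<forall>v\<in>V. tensor_form_frag E H \<pi> u v = c)"

text \<open>
  Condition (P). Since HOL cannot quantify over types inside a formula, the type \<open>'h\<close> in which the
  pre-Hilbert spaces live is a parameter; a theorem with this condition as conclusion and
  arbitrary \<open>'h\<close> covers all pre-Hilbert spaces.
\<close>

definition condition_P ::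
  "('r::linordered_idom cx, 'a, 'm) star_alg_scheme \<Rightarrow>
   ('r cx, 'a, 'e, 'k) inner_module_scheme \<Rightarrow> 'h itself \<Rightarrow> bool" where
  "condition_P A E _ \<longleftrightarrow>
     (\<forall>(H :: ('r cx, 'h) prehilbert) \<pi>. pre_hilbert_space H \<and> star_representation A H \<pi> \<longrightarrow>
        (\<forall>U\<in>carrier (tensor_product A E H \<pi>). cx_nonneg (tensor_form E H \<pi> U U)))"

text \<open>
  The complex-conjugate of a (B-A)-bimodule as a right \<open>B\<close>-module with \<open>B\<close>-valued inner product;
  condition (Q) is condition (P) for it.
\<close>

definition conjugate_module ::
  "('r::linordered_idom cx, 'b, 'm) star_alg_scheme \<Rightarrow>
   ('r cx, 'b, 'a, 'e, 'k) inner_bimodule_scheme \<Rightarrow> ('r cx, 'b, 'e) inner_module" where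
  "conjugate_module B E =
     \<lparr>carrier = carrier E, monoid.mult = monoid.mult E, one = one E, zero = zero E, add = add E,
      module.smult = (\<lambda>c x. cx_cnj c \<odot>\<^bsub>E\<^esub> x),
      ract = (\<lambda>x b. lact E (star B b) x), rip = lip E\<rparr>"

definition module_span :: "('r::linordered_idom cx, 'a, 'm) module_scheme \<Rightarrow> 'a set \<Rightarrow> 'a set" where
  "module_span M S = \<Inter>{N. submodule N scalars M \<and> S \<subseteq> N}"

locale bimodule = B: star_algebra B + A: star_algebra A + E: module scalars E
  for B :: "('r::linordered_idom cx, 'b, 'm) star_alg_scheme"
    and A :: "('r cx, 'a, 'k) star_alg_scheme"
    and E :: "('r cx, 'b, 'a, 'e, 'l) inner_bimodule_scheme" +
  assumes lact_closed: "b \<in> carrier B \<Longrightarrow> x \<in> carrier E \<Longrightarrow> lact E b x \<in> carrier E"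
    and lact_add_left: "b \<in> carrier B \<Longrightarrow> b' \<in> carrier B \<Longrightarrow> x \<in> carrier E \<Longrightarrow>
          lact E (b \<oplus>\<^bsub>B\<^esub> b') x = lact E b x \<oplus>\<^bsub>E\<^esub> lact E b' x"
    and lact_add_right: "b \<in> carrier B \<Longrightarrow> x \<in> carrier E \<Longrightarrow> y \<in> carrier E \<Longrightarrow>
          lact E b (x \<oplus>\<^bsub>E\<^esub> y) = lact E b x \<oplus>\<^bsub>E\<^esub> lact E b y"
    and lact_smult_left: "b \<in> carrier B \<Longrightarrow> x \<in> carrier E \<Longrightarrow>
          lact E (c \<odot>\<^bsub>B\<^esub> b) x = c \<odot>\<^bsub>E\<^esub> lact E b x"
    and lact_smult_right: "b \<in> carrier B \<Longrightarrow> x \<in> carrier E \<Longrightarrow>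
          lact E b (c \<odot>\<^bsub>E\<^esub> x) = c \<odot>\<^bsub>E\<^esub> lact E b x"
    and lact_mult: "b \<in> carrier B \<Longrightarrow> b' \<in> carrier B \<Longrightarrow> x \<in> carrier E \<Longrightarrow>
          lact E (b \<otimes>\<^bsub>B\<^esub> b') x = lact E b (lact E b' x)"
    and ract_closed: "x \<in> carrier E \<Longrightarrow> a \<in> carrier A \<Longrightarrow> ract E x a \<in> carrier E"
    and ract_add_left: "x \<in> carrier E \<Longrightarrow> y \<in> carrier E \<Longrightarrow> a \<in> carrier A \<Longrightarrow>
          ract E (x \<oplus>\<^bsub>E\<^esub> y) a = ract E x a \<oplus>\<^bsub>E\<^esub> ract E y a"
    and ract_add_right: "x \<in> carrier E \<Longrightarrow> a \<in> carrier A \<Longrightarrow> a' \<in> carrier A \<Longrightarrow>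
          ract E x (a \<oplus>\<^bsub>A\<^esub> a') = ract E x a \<oplus>\<^bsub>E\<^esub> ract E x a'"
    and ract_smult_left: "x \<in> carrier E \<Longrightarrow> a \<in> carrier A \<Longrightarrow>
          ract E (c \<odot>\<^bsub>E\<^esub> x) a = c \<odot>\<^bsub>E\<^esub> ract E x a"
    and ract_smult_right: "x \<in> carrier E \<Longrightarrow> a \<in> carrier A \<Longrightarrow>
          ract E x (c \<odot>\<^bsub>A\<^esub> a) = c \<odot>\<^bsub>E\<^esub> ract E x a"
    and ract_mult: "x \<in> carrier E \<Longrightarrow> a \<in> carrier A \<Longrightarrow> a' \<in> carrier A \<Longrightarrow>
          ract E x (a \<otimes>\<^bsub>A\<^esub> a') = ract E (ract E x a) a'"
    and lact_ract: "b \<in> carrier B \<Longrightarrow> x \<in> carrier E \<Longrightarrow> a \<in> carrier A \<Longrightarrow>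
          ract E (lact E b x) a = lact E b (ract E x a)"

locale equivalence_bimodule = bimodule B A E
  for B :: "('r::linordered_idom cx, 'b, 'm) star_alg_scheme"
    and A :: "('r cx, 'a, 'k) star_alg_scheme"
    and E :: "('r cx, 'b, 'a, 'e, 'l) inner_bimodule_scheme" +
  fixes H_type :: "'h itself"
  assumes rip_closed: "x \<in> carrier E \<Longrightarrow> y \<in> carrier E \<Longrightarrow> rip E x y \<in> carrier A"
    and rip_add: "x \<in> carrier E \<Longrightarrow> y \<in> carrier E \<Longrightarrow> z \<in> carrier E \<Longrightarrow>
          rip E x (y \<oplus>\<^bsub>E\<^esub> z) = rip E x y \<oplus>\<^bsub>A\<^esub> rip E x z"
    and rip_smult: "x \<in> carrier E \<Longrightarrow> y \<in> carrier E \<Longrightarrow>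
          rip E x (c \<odot>\<^bsub>E\<^esub> y) = c \<odot>\<^bsub>A\<^esub> rip E x y"
    and rip_ract: "x \<in> carrier E \<Longrightarrow> y \<in> carrier E \<Longrightarrow> a \<in> carrier A \<Longrightarrow>
          rip E x (ract E y a) = rip E x y \<otimes>\<^bsub>A\<^esub> a"
    and rip_star: "x \<in> carrier E \<Longrightarrow> y \<in> carrier E \<Longrightarrow> star A (rip E x y) = rip E y x"
    and rip_pos: "x \<in> carrier E \<Longrightarrow> rip E x x \<in> positive_elements A"
    and rip_full: "module_span A {rip E x y | x y. x \<in> carrier E \<and> y \<in> carrier E} = carrier A"
    and lip_closed: "x \<in> carrier E \<Longrightarrow> y \<in> carrier E \<Longrightarrow> lip E x y \<in> carrier B"
    and lip_add: "x \<in> carrier E \<Longrightarrow> y \<in> carrier E \<Longrightarrow> z \<in> carrier E \<Longrightarrow>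
          lip E (x \<oplus>\<^bsub>E\<^esub> y) z = lip E x z \<oplus>\<^bsub>B\<^esub> lip E y z"
    and lip_smult: "x \<in> carrier E \<Longrightarrow> y \<in> carrier E \<Longrightarrow>
          lip E (c \<odot>\<^bsub>E\<^esub> x) y = c \<odot>\<^bsub>B\<^esub> lip E x y"
    and lip_lact: "x \<in> carrier E \<Longrightarrow> y \<in> carrier E \<Longrightarrow> b \<in> carrier B \<Longrightarrow>
          lip E (lact E b x) y = b \<otimes>\<^bsub>B\<^esub> lip E x y"
    and lip_star: "x \<in> carrier E \<Longrightarrow> y \<in> carrier E \<Longrightarrow> star B (lip E x y) = lip E y x"
    and lip_pos: "x \<in> carrier E \<Longrightarrow> lip E x x \<in> positive_elements B"
    and lip_full: "module_span B {lip E x y | x y. x \<in> carrier E \<and> y \<in> carrier E} = carrier B"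
    and rip_lact: "x \<in> carrier E \<Longrightarrow> y \<in> carrier E \<Longrightarrow> b \<in> carrier B \<Longrightarrow>
          rip E x (lact E b y) = rip E (lact E (star B b) x) y"
    and lip_ract: "x \<in> carrier E \<Longrightarrow> y \<in> carrier E \<Longrightarrow> a \<in> carrier A \<Longrightarrow>
          lip E x (ract E y a) = lip E (ract E x (star A a)) y"
    and lip_rip: "x \<in> carrier E \<Longrightarrow> y \<in> carrier E \<Longrightarrow> z \<in> carrier E \<Longrightarrow>
          lact E (lip E x y) z = ract E x (rip E y z)"
    and P: "condition_P A E H_type"
    and Q: "condition_P B (conjugate_module B E) H_type"

definition nondegenerate ::
  "('c, 'b, 'm) star_alg_scheme \<Rightarrow> ('c, 'a, 'k) star_alg_scheme \<Rightarrow>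
   ('c, 'b, 'a, 'e, 'l) inner_bimodule_scheme \<Rightarrow> bool" where
  "nondegenerate B A E \<longleftrightarrow>
     (\<forall>x\<in>carrier E. lact E \<one>\<^bsub>B\<^esub> x = x \<and> ract E x \<one>\<^bsub>A\<^esub> = x)"

text \<open>As for (P), the types of the bimodule elements and of the pre-Hilbert spaces are parameters.\<close>

definition formally_Morita_equivalent ::
  "('r::linordered_idom cx, 'b, 'm) star_alg_scheme \<Rightarrow> ('r cx, 'a, 'k) star_alg_scheme \<Rightarrow>
   'e itself \<Rightarrow> 'h itself \<Rightarrow> bool" where
  "formally_Morita_equivalent B A _ _ \<longleftrightarrow>
     (\<exists>E :: ('r cx, 'b, 'a, 'e) inner_bimodule. equivalence_bimodule B A E TYPE('h))"


section \<open>Matrix algebras, projections, and the bimodule of a projection\<close>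

text \<open>Matrices and column vectors are indexed by a finite type with \<open>n\<close> elements.\<close>

definition matrix_algebra ::
  "('c, 'a, 'm) star_alg_scheme \<Rightarrow> ('c, 'n::finite \<Rightarrow> 'n \<Rightarrow> 'a) star_alg" where
  "matrix_algebra A =
     \<lparr>carrier = {L. \<forall>i j. L i j \<in> carrier A},
      monoid.mult = (\<lambda>K L i j. \<Oplus>\<^bsub>A\<^esub>k\<in>UNIV. K i k \<otimes>\<^bsub>A\<^esub> L k j),
      one = (\<lambda>i j. if i = j then \<one>\<^bsub>A\<^esub> else \<zero>\<^bsub>A\<^esub>),
      zero = (\<lambda>i j. \<zero>\<^bsub>A\<^esub>),
      add = (\<lambda>K L i j. K i j \<oplus>\<^bsub>A\<^esub> L i j),
      module.smult = (\<lambda>c L i j. c \<odot>\<^bsub>A\<^esub> L i j),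
      star = (\<lambda>L i j. star A (L j i))\<rparr>"

definition matrix_vector ::
  "('c, 'a, 'm) star_alg_scheme \<Rightarrow> ('n::finite \<Rightarrow> 'n \<Rightarrow> 'a) \<Rightarrow> ('n \<Rightarrow> 'a) \<Rightarrow> 'n \<Rightarrow> 'a" where
  "matrix_vector A L v = (\<lambda>i. \<Oplus>\<^bsub>A\<^esub>k\<in>UNIV. L i k \<otimes>\<^bsub>A\<^esub> v k)"

definition matrix_trace ::
  "('c, 'a, 'm) star_alg_scheme \<Rightarrow> ('n::finite \<Rightarrow> 'n \<Rightarrow> 'a) \<Rightarrow> 'a" where
  "matrix_trace A L = (\<Oplus>\<^bsub>A\<^esub>i\<in>UNIV. L i i)"

definition projection :: "('c, 'a, 'm) star_alg_scheme \<Rightarrow> 'a \<Rightarrow> bool" where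
  "projection A p \<longleftrightarrow> p \<in> carrier A \<and> star A p = p \<and> p \<otimes>\<^bsub>A\<^esub> p = p"

definition strongly_full_projection ::
  "('c, 'a, 'm) star_alg_scheme \<Rightarrow> ('n::finite \<Rightarrow> 'n \<Rightarrow> 'a) \<Rightarrow> bool" where
  "strongly_full_projection A L \<longleftrightarrow> projection (matrix_algebra A) L \<and>
     (\<exists>\<tau>\<in>Units A. matrix_trace A L = inv\<^bsub>A\<^esub> (\<tau> \<otimes>\<^bsub>A\<^esub> star A \<tau>))"

definition corner_algebra :: "('c, 'a) star_alg \<Rightarrow> 'a \<Rightarrow> ('c, 'a) star_alg" where
  "corner_algebra A p = A\<lparr>carrier := (\<lambda>a. p \<otimes>\<^bsub>A\<^esub> a \<otimes>\<^bsub>A\<^esub> p) ` carrier A, one := p\<rparr>"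

text \<open>The right \<open>A\<close>-module \<open>P A\<^sup>n\<close> with its canonical \<open>A\<close>-valued inner product.\<close>

definition projective_module ::
  "('c, 'a, 'm) star_alg_scheme \<Rightarrow> ('n::finite \<Rightarrow> 'n \<Rightarrow> 'a) \<Rightarrow> ('c, 'a, 'n \<Rightarrow> 'a) inner_module" where
  "projective_module A L =
     \<lparr>carrier = matrix_vector A L ` {v. \<forall>i. v i \<in> carrier A},
      monoid.mult = undefined, one = undefined,
      zero = (\<lambda>i. \<zero>\<^bsub>A\<^esub>),
      add = (\<lambda>x y i. x i \<oplus>\<^bsub>A\<^esub> y i),
      module.smult = (\<lambda>c x i. c \<odot>\<^bsub>A\<^esub> x i),
      ract = (\<lambda>x a i. x i \<otimes>\<^bsub>A\<^esub> a),
      rip = (\<lambda>x y. \<Oplus>\<^bsub>A\<^esub>i\<in>UNIV. star A (x i) \<otimes>\<^bsub>A\<^esub> y i)\<rparr>"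

text \<open>
  The endomorphisms of a right \<open>A\<close>-module \<open>E\<close> (as functions undefined outside the carrier); the
  involution is the adjoint with respect to the inner product. For \<open>E = P A\<^sup>n\<close> adjoints
  exist and are unique.
\<close>

definition module_endos ::
  "('c, 'a, 'm) star_alg_scheme \<Rightarrow> ('c, 'a, 'e, 'k) inner_module_scheme \<Rightarrow> ('e \<Rightarrow> 'e) set" where
  "module_endos A E =
     {T \<in> carrier E \<rightarrow>\<^sub>E carrier E.
        (\<forall>x\<in>carrier E. \<forall>y\<in>carrier E. T (x \<oplus>\<^bsub>E\<^esub> y) = T x \<oplus>\<^bsub>E\<^esub> T y) \<and>
        (\<forall>c. \<forall>x\<in>carrier E. T (c \<odot>\<^bsub>E\<^esub> x) = c \<odot>\<^bsub>E\<^esub> T x) \<and>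
        (\<forall>x\<in>carrier E. \<forall>a\<in>carrier A. T (ract E x a) = ract E (T x) a)}"

definition End_algebra ::
  "('c, 'a, 'm) star_alg_scheme \<Rightarrow> ('c, 'a, 'e, 'k) inner_module_scheme \<Rightarrow>
   ('c, 'e \<Rightarrow> 'e) star_alg" where
  "End_algebra A E =
     \<lparr>carrier = module_endos A E,
      monoid.mult = (\<lambda>S T. compose (carrier E) S T),
      one = (\<lambda>x\<in>carrier E. x),
      zero = (\<lambda>x\<in>carrier E. \<zero>\<^bsub>E\<^esub>),
      add = (\<lambda>S T. \<lambda>x\<in>carrier E. S x \<oplus>\<^bsub>E\<^esub> T x),
      module.smult = (\<lambda>c T. \<lambda>x\<in>carrier E. c \<odot>\<^bsub>E\<^esub> T x),
      star = (\<lambda>T. THE S. S \<in> module_endos A E \<and>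
                (\<forall>x\<in>carrier E. \<forall>y\<in>carrier E. rip E x (T y) = rip E (S x) y))\<rparr>"

text \<open>\<open>P A\<^sup>n\<close> as a bimodule over its endomorphism algebra, with \<open>\<Theta>\<^sub>x\<^sub>,\<^sub>y z = x \<langle>y, z\<rangle>\<close>.\<close>

definition projective_bimodule ::
  "('c, 'a, 'm) star_alg_scheme \<Rightarrow> ('n::finite \<Rightarrow> 'n \<Rightarrow> 'a) \<Rightarrow>
   ('c, ('n \<Rightarrow> 'a) \<Rightarrow> 'n \<Rightarrow> 'a, 'a, 'n \<Rightarrow> 'a) inner_bimodule" where
  "projective_bimodule A L = (let E = projective_module A L in
     inner_module.extend E
       (inner_bimodule.fields
          (\<lambda>T x. T x)
          (\<lambda>x y. \<lambda>z\<in>carrier E. ract E x (rip E y z))))"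


section \<open>Formal deformations\<close>

text \<open>
  Elements of \<open>A[[\<lambda>]]\<close> are represented by their coefficient sequences. The \<open>C[[\<lambda>]]\<close>-action is
  the Cauchy product, and the involution acts on coefficients (so \<open>\<lambda>\<^sup>* = \<lambda>\<close>). Only the product is
  deformed.
\<close>

definition const_series :: "('c, 'a, 'm) star_alg_scheme \<Rightarrow> 'a \<Rightarrow> nat \<Rightarrow> 'a" where
  "const_series A a = (\<lambda>r. if r = 0 then a else \<zero>\<^bsub>A\<^esub>)"

definition deformed_algebra ::
  "('r::linordered_idom cx, 'a, 'm) star_alg_scheme \<Rightarrow>
   ((nat \<Rightarrow> 'a) \<Rightarrow> (nat \<Rightarrow> 'a) \<Rightarrow> nat \<Rightarrow> 'a) \<Rightarrow> ('r fps cx, nat \<Rightarrow> 'a) star_alg" where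
  "deformed_algebra A m =
     \<lparr>carrier = {f. \<forall>r. f r \<in> carrier A},
      monoid.mult = m,
      one = const_series A \<one>\<^bsub>A\<^esub>,
      zero = (\<lambda>r. \<zero>\<^bsub>A\<^esub>),
      add = (\<lambda>f g r. f r \<oplus>\<^bsub>A\<^esub> g r),
      module.smult = (\<lambda>z f r. \<Oplus>\<^bsub>A\<^esub>k\<in>{..r}. cx_fps_nth z k \<odot>\<^bsub>A\<^esub> f (r - k)),
      star = (\<lambda>f r. star A (f r))\<rparr>"

definition bilinear_map ::
  "('c, 'a, 'm) star_alg_scheme \<Rightarrow> ('a \<Rightarrow> 'a \<Rightarrow> 'a) \<Rightarrow> bool" where
  "bilinear_map A b \<longleftrightarrow>
     (\<forall>x\<in>carrier A. \<forall>y\<in>carrier A. b x y \<in> carrier A) \<and>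
     (\<forall>x\<in>carrier A. \<forall>y\<in>carrier A. \<forall>z\<in>carrier A.
        b (x \<oplus>\<^bsub>A\<^esub> y) z = b x z \<oplus>\<^bsub>A\<^esub> b y z \<and> b x (y \<oplus>\<^bsub>A\<^esub> z) = b x y \<oplus>\<^bsub>A\<^esub> b x z) \<and>
     (\<forall>c. \<forall>x\<in>carrier A. \<forall>y\<in>carrier A.
        b (c \<odot>\<^bsub>A\<^esub> x) y = c \<odot>\<^bsub>A\<^esub> b x y \<and> b x (c \<odot>\<^bsub>A\<^esub> y) = c \<odot>\<^bsub>A\<^esub> b x y)"

locale formal_deformation = star_algebra A
  for A :: "('r::linordered_idom cx, 'a, 'm) star_alg_scheme" (structure) +
  fixes m :: "(nat \<Rightarrow> 'a) \<Rightarrow> (nat \<Rightarrow> 'a) \<Rightarrow> nat \<Rightarrow> 'a" (infixl \<open>\<star>\<close> 70)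
  assumes bilinear: "bilinear_map (deformed_algebra A m) m"
    and assoc: "f \<in> carrier (deformed_algebra A m) \<Longrightarrow> g \<in> carrier (deformed_algebra A m) \<Longrightarrow>
          h \<in> carrier (deformed_algebra A m) \<Longrightarrow> (f \<star> g) \<star> h = f \<star> (g \<star> h)"
    and cochains: "\<exists>C :: nat \<Rightarrow> 'a \<Rightarrow> 'a \<Rightarrow> 'a. (\<forall>r. bilinear_map A (C r)) \<and>
          (\<forall>a\<in>carrier A. \<forall>b\<in>carrier A. C 0 a b = a \<otimes> b) \<and>
          (\<forall>a\<in>carrier A. \<forall>b\<in>carrier A.
             const_series A a \<star> const_series A b = (\<lambda>r. C r a b))"
    and unit: "f \<in> carrier (deformed_algebra A m) \<Longrightarrow>
          const_series A \<one> \<star> f = f \<and> f \<star> const_series A \<one> = f"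

locale hermitian_deformation = formal_deformation A m
  for A :: "('r::linordered_idom cx, 'a, 'm) star_alg_scheme" (structure)
    and m :: "(nat \<Rightarrow> 'a) \<Rightarrow> (nat \<Rightarrow> 'a) \<Rightarrow> nat \<Rightarrow> 'a" (infixl \<open>\<star>\<close> 70) +
  assumes hermitian: "f \<in> carrier (deformed_algebra A m) \<Longrightarrow>
      g \<in> carrier (deformed_algebra A m) \<Longrightarrow>
      star (deformed_algebra A m) (f \<star> g) =
        star (deformed_algebra A m) g \<star> star (deformed_algebra A m) f"

end

theory Submission
  imports Defs
begin

text \<open>
  Strong fullness is stable: if \<open>tr P\<^sub>0 = (\<tau>\<tau>\<^sup>*)\<^sup>-\<^sup>1\<close>, then \<open>\<tau>\<^sup>* \<star> tr P \<star> \<tau> = 1 + O(\<lambda>)\<close> is Hermitian and, since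
  \<open>1/2 \<in> R\<close>, has an invertible Hermitian square root \<open>s\<close>; the element \<open>\<tau> \<star> s\<^sup>-\<^sup>1\<close> then takes the role of \<open>\<tau>\<close>.

  For a strongly full projection \<open>P\<close> over any unital *-algebra \<open>A\<close>, the vectors \<open>y\<^sub>j = P e\<^sub>j \<tau>\<close> satisfy
  \<open>\<Sum>\<^sub>j \<langle>y\<^sub>j, y\<^sub>j\<rangle> = \<tau>\<^sup>* tr P \<tau> = 1\<close>. This gives fullness of \<open>\<langle>_, _\<rangle>\<close>, and it turns
  \<open>\<Theta>(x, y) = \<Sum>\<^sub>j \<Theta>(y\<^sub>j, x)\<^sup>* \<Theta>(y\<^sub>j, y)\<close> into a sum of squares, just like \<open>\<langle>x, y\<rangle> = \<Sum>\<^sub>i x\<^sub>i\<^sup>* y\<^sub>i\<close>. Both inner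
  products are therefore positive, and for the same reason (P) and (Q) hold.
\<close>

section \<open>Star algebras and their scalars\<close>

text \<open>The obstacle in the first half is that the given \<tau> normalizes the trace of P only
  to zeroth order in lambda. The root correcting it is built coefficient by coefficient: for s = 1 +
  u the equation s s = w reads u = (w - 1 - u u) / 2, and with u = O(lambda) the right side at order
  N involves u only below N. Inverses come from the same fixed point principle. The product
  \<open>m\<close> is a function on sequences whose cochains are given on constant series only, so
  the continuity behind these arguments is extracted from bilinearity over power series, by dividing
  out powers of lambda.

  In the second half, positivity of <x, x> alone does not control the matrices of inner products
  that enter (P) and (Q); a sum of squares with linear coordinates does. The coordinates also show
  that the form, defined as the common value on all representatives, is well defined. The involution
  of the endomorphism algebra is a definite description of the adjoint: adjoints exist because
  endomorphisms of P A^n are matrices in the corner P M_n P, and they are unique because the inner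
  product separates vectors.\<close>

lemma scalars_simps [simp]:
  "carrier scalars = UNIV" "a \<oplus>\<^bsub>scalars\<^esub> b = a + b" "a \<otimes>\<^bsub>scalars\<^esub> b = a * b"
  "\<zero>\<^bsub>scalars\<^esub> = 0" "\<one>\<^bsub>scalars\<^esub> = 1"
  by (simp_all add: ring_of_type_algebra_def)

lemma cring_scalars: "cring (scalars :: 'r::linordered_idom cx ring)"
  by (rule cring_from_type_algebra)

lemma cx_cnj_simps [simp]:
  "cx_cnj 0 = 0" "cx_cnj (z + w) = cx_cnj z + cx_cnj w" "cx_cnj (z * w) = cx_cnj z * cx_cnj w"
  "cx_cnj (cx_cnj z) = z"
  by (simp_all add: cx_cnj_def zero_cx_def plus_cx_def times_cx_def)

lemma cx_nonneg_sum: "(\<And>i. i \<in> I \<Longrightarrow> cx_nonneg (f i)) \<Longrightarrow> cx_nonneg (\<Sum>i\<in>I. f i)"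
  by (induction I rule: infinite_finite_induct) (auto simp: cx_nonneg_def zero_cx_def plus_cx_def)

lemma (in abelian_group) additive_finsum:
  fixes \<omega> :: "'a \<Rightarrow> 'c::ab_group_add"
  assumes add: "\<And>x y. x \<in> carrier G \<Longrightarrow> y \<in> carrier G \<Longrightarrow> \<omega> (x \<oplus> y) = \<omega> x + \<omega> y"
    and "finite I" and "f \<in> I \<rightarrow> carrier G"
  shows "\<omega> (finsum G f I) = (\<Sum>i\<in>I. \<omega> (f i))"
proof -
  have "\<omega> \<zero> = 0"
    using add[of \<zero> \<zero>] by simp
  with assms(2,3) show ?thesis
    by (induction I) (auto simp: add)
qed

lemma (in abelian_group) additive_map_zero:
  assumes "abelian_group H" "\<And>x. x \<in> carrier G \<Longrightarrow> h x \<in> carrier H"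
    "\<And>x y. x \<in> carrier G \<Longrightarrow> y \<in> carrier G \<Longrightarrow> h (x \<oplus> y) = h x \<oplus>\<^bsub>H\<^esub> h y"
  shows "h \<zero> = \<zero>\<^bsub>H\<^esub>"
proof -
  interpret H: abelian_group H by fact
  have "h \<zero> \<oplus>\<^bsub>H\<^esub> h \<zero> = h \<zero>"
    using assms(3)[of \<zero> \<zero>] by simp
  then show ?thesis
    using assms(2)[of \<zero>] by (simp add: H.add.r_cancel_one)
qed

lemma (in abelian_group) additive_map_finsum:
  assumes H: "abelian_group H" and cl: "\<And>x. x \<in> carrier G \<Longrightarrow> h x \<in> carrier H"
    and add: "\<And>x y. x \<in> carrier G \<Longrightarrow> y \<in> carrier G \<Longrightarrow> h (x \<oplus> y) = h x \<oplus>\<^bsub>H\<^esub> h y"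
    and "finite I" and "f \<in> I \<rightarrow> carrier G"
  shows "h (finsum G f I) = (\<Oplus>\<^bsub>H\<^esub>i\<in>I. h (f i))"
proof -
  interpret H: abelian_group H by fact
  have "h \<zero> = \<zero>\<^bsub>H\<^esub>"
    using H cl add by (rule additive_map_zero)
  with assms(4,5) show ?thesis
  proof (induction I)
    case (insert i I)
    then have "(\<lambda>i. h (f i)) \<in> I \<rightarrow> carrier H" "h (f i) \<in> carrier H"
      using cl by auto
    with insert show ?case
      by (auto simp: add)
  qed auto
qed

lemma (in abelian_monoid) finsum_swap:
  assumes "finite S" "finite T" "\<And>s t. s \<in> S \<Longrightarrow> t \<in> T \<Longrightarrow> f s t \<in> carrier G"
  shows "(\<Oplus>s\<in>S. \<Oplus>t\<in>T. f s t) = (\<Oplus>t\<in>T. \<Oplus>s\<in>S. f s t)"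
  using assms(1,3)
proof (induction S)
  case (insert s S)
  have "(\<Oplus>t\<in>T. \<Oplus>s\<in>insert s S. f s t) = (\<Oplus>t\<in>T. f s t \<oplus> (\<Oplus>s\<in>S. f s t))"
    using insert by (intro finsum_cong') (auto intro!: finsum_closed)
  also have "\<dots> = (\<Oplus>t\<in>T. f s t) \<oplus> (\<Oplus>t\<in>T. \<Oplus>s\<in>S. f s t)"
    using insert by (intro finsum_addf) (auto intro!: finsum_closed)
  also have "(\<Oplus>t\<in>T. \<Oplus>s\<in>S. f s t) = (\<Oplus>s\<in>S. \<Oplus>t\<in>T. f s t)"
    using insert by simp
  finally show ?case
    using insert by (simp add: finsum_closed)
qed auto

text \<open>Both sides run over the pairs with i + j \<le> n, grouped by the total k = i + j or by
  i. This is the reindexing that makes the Cauchy product of scalars act associatively on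
  series.\<close>

lemma (in abelian_monoid) finsum_triangle:
  fixes f :: "nat \<Rightarrow> nat \<Rightarrow> 'a"
  assumes "\<And>i j. f i j \<in> carrier G"
  shows "(\<Oplus>k\<in>{..n}. \<Oplus>i\<in>{..k}. f i (k - i)) = (\<Oplus>i\<in>{..n}. \<Oplus>j\<in>{..n-i}. f i j)"
proof (induction n)
  case (Suc n)
  have "(\<Oplus>i\<in>{..n}. \<Oplus>j\<in>{..Suc n-i}. f i j)
      = (\<Oplus>i\<in>{..n}. f i (Suc n - i) \<oplus> (\<Oplus>j\<in>{..n-i}. f i j))"
    using assms by (intro finsum_cong') (auto simp: Suc_diff_le intro!: finsum_closed)
  also have "\<dots> = (\<Oplus>i\<in>{..n}. f i (Suc n - i)) \<oplus> (\<Oplus>i\<in>{..n}. \<Oplus>j\<in>{..n-i}. f i j)"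
    using assms by (intro finsum_addf) (auto intro!: finsum_closed)
  finally show ?case
    using Suc assms by (simp add: finsum_closed a_assoc)
qed (use assms in simp)

lemma (in monoid) inv_mult_Units:
  assumes "x \<in> Units G" "y \<in> Units G"
  shows "inv (x \<otimes> y) = inv y \<otimes> inv x"
proof (rule inv_char)
  have "x \<otimes> y \<otimes> (inv y \<otimes> inv x) = x \<otimes> (y \<otimes> inv y) \<otimes> inv x"
    using assms by (simp add: m_assoc Units_closed del: Units_r_inv)
  then show "x \<otimes> y \<otimes> (inv y \<otimes> inv x) = \<one>"
    using assms by (simp add: Units_closed)
  have "inv y \<otimes> inv x \<otimes> (x \<otimes> y) = inv y \<otimes> (inv x \<otimes> x) \<otimes> y"
    using assms by (simp add: m_assoc Units_closed del: Units_l_inv)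
  then show "inv y \<otimes> inv x \<otimes> (x \<otimes> y) = \<one>"
    using assms by (simp add: Units_closed)
qed (use assms in auto)

context star_algebra
begin

text \<open>
  The locale \<open>module\<close> brings in the ring facts of the scalars under the same names as those of \<open>A\<close>, which
  are therefore only accessible by instantiation.
\<close>

lemma abelian_group_carrier: "abelian_group A"
  by unfold_locales

lemma ring_carrier: "ring A"
  by unfold_locales

lemma monoid_carrier: "monoid A"
  by unfold_locales

lemma smult_closed' [simp, intro]: "x \<in> carrier A \<Longrightarrow> c \<odot> x \<in> carrier A"
  by simp

lemmas smult_add_left = smult_l_distr[simplified]
lemmas smult_add_right = smult_r_distr[simplified]
lemmas smult_assoc = smult_assoc1[simplified]
lemmas smult_1 [simp] = smult_one[simplified]
lemmas smult_0_left [simp] = smult_l_null[simplified]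

declare star_closed [simp, intro] star_star [simp]

lemma star_zero [simp]: "star A \<zero> = \<zero>"
  by (rule abelian_group.additive_map_zero[OF abelian_group_carrier abelian_group_carrier]) (auto simp: star_add)

lemma star_one [simp]: "star A \<one> = \<one>"
proof -
  \<comment> \<open>The left side simplifies to \<one> and the right side to
    \<open>star A \<one>\<close>.\<close>
  have "star A (star A \<one> \<otimes> \<one>) = star A \<one> \<otimes> star A (star A \<one>)"
    by (rule star_mult) simp_all
  then show ?thesis
    by simp
qed

lemma star_minus: "x \<in> carrier A \<Longrightarrow> star A (\<ominus> x) = \<ominus> star A x"
  by (rule sym, rule abelian_group.minus_equality[OF abelian_group_carrier])
    (simp_all add: star_add[symmetric] ring.ring_simprules[OF ring_carrier])

lemma star_finsum:
  "finite I \<Longrightarrow> f \<in> I \<rightarrow> carrier A \<Longrightarrow> star A (finsum A f I) = (\<Oplus>i\<in>I. star A (f i))"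
  by (rule abelian_group.additive_map_finsum[OF abelian_group_carrier abelian_group_carrier]) (auto simp: star_add)

lemma star_Units:
  assumes "a \<in> Units A"
  shows "star A a \<in> Units A"
proof -
  have "star A a \<otimes> star A (inv a) = \<one>" "star A (inv a) \<otimes> star A a = \<one>"
    using assms monoid.Units_closed[OF monoid_carrier assms] by (simp_all add: star_mult[symmetric])
  moreover have "a \<in> carrier A" "inv a \<in> carrier A"
    using assms monoid.Units_closed[OF monoid_carrier assms] by simp_all
  ultimately show ?thesis
    unfolding Units_def by blast
qed

text \<open>Positive functionals are additive and nonnegative on each square. Positivity of both
  inner products is drawn from this, with the entries of x as \<open>f\<close> for
  \<open>rip\<close> and with rank-one operators as \<open>f\<close> for \<open>lip\<close>.\<close>

lemma sum_of_squares_positive: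
  assumes "finite I" "f \<in> I \<rightarrow> carrier A"
  shows "(\<Oplus>i\<in>I. star A (f i) \<otimes> f i) \<in> positive_elements A"
proof -
  have f: "(\<lambda>i. star A (f i) \<otimes> f i) \<in> I \<rightarrow> carrier A"
    using assms by auto
  have "cx_nonneg (\<omega> (\<Oplus>i\<in>I. star A (f i) \<otimes> f i))" if "positive_functional A \<omega>" for \<omega>
  proof -
    have "\<omega> (\<Oplus>i\<in>I. star A (f i) \<otimes> f i) = (\<Sum>i\<in>I. \<omega> (star A (f i) \<otimes> f i))"
      using that assms(1) f by (intro abelian_group.additive_finsum[OF abelian_group_carrier]) (auto simp: positive_functional_def)
    also have "cx_nonneg \<dots>"
      using that assms by (intro cx_nonneg_sum) (auto simp: positive_functional_def)
    finally show ?thesis .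
  qed
  then show ?thesis
    using f by (auto simp: positive_elements_def intro!: finsum_closed)
qed

text \<open>A submodule containing S contains all finite sums of elements of S. Fullness is thereby
  reduced to writing each element as a plain sum of inner products.\<close>

lemma module_span_eq_carrier:
  assumes "S \<subseteq> carrier A" and "finite I"
    and "\<And>a. a \<in> carrier A \<Longrightarrow> \<exists>f \<in> I \<rightarrow> S. a = (\<Oplus>i\<in>I. f i)"
  shows "module_span A S = carrier A"
proof -
  have "carrier A \<subseteq> N" if N: "submodule N scalars A" "S \<subseteq> N" for N
  proof
    fix a assume "a \<in> carrier A"
    then obtain f where f: "f \<in> I \<rightarrow> S" "a = (\<Oplus>i\<in>I. f i)"
      using assms(3) by blast
    \<comment> \<open>A submodule is nonempty and closed under scalars, so it contains zero as 0
      times any of its elements; this starts the induction on I.\<close>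
    have "0 \<odot> x = \<zero>" if "x \<in> N" for x
      using submoduleE(1)[OF N(1)] that by auto
    then have "\<zero> \<in> N"
      using submoduleE(2)[OF N(1)] submoduleE(4)[OF N(1)] by (metis UNIV_I all_not_in_conv scalars_simps(1))
    with \<open>finite I\<close> f(1) have "(\<Oplus>i\<in>I. f i) \<in> N"
    proof (induction I)
      case (insert i I)
      then have "f \<in> I \<rightarrow> carrier A" "f i \<in> carrier A" using assms(1) by auto
      with insert N show ?case
        by (auto intro: submoduleE(5)[OF N(1)])
    qed auto
    with f show "a \<in> N" by simp
  qed
  moreover have "submodule (carrier A) scalars A"
    by (rule carrier_is_submodule)
  ultimately show ?thesis
    unfolding module_span_def using assms(1) by blast
qed

end

section \<open>Positivity of the internal tensor product\<close>

text \<open>In this nested shape the form is a weighted sum over the support in either argument, so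
  \<open>frag_sum_diff\<close> applies to both.\<close>

lemma tensor_form_frag_alt:
  "tensor_form_frag E H \<pi> u v =
     (\<Sum>p\<in>Poly_Mapping.keys u. of_int (Poly_Mapping.lookup u p) *
       (\<Sum>q\<in>Poly_Mapping.keys v. of_int (Poly_Mapping.lookup v q) *
          ip H (snd p) (\<pi> (rip E (fst p) (fst q)) (snd q))))"
  unfolding tensor_form_frag_def
  by (simp add: case_prod_beta sum_distrib_left mult.assoc)

text \<open>The support of u - v may shrink by cancellation. All three sums are therefore extended
  to the union of the two supports, where the additional coefficients vanish.\<close>

lemma frag_sum_diff:
  fixes G :: "'k \<Rightarrow> 'c::comm_ring_1"
  shows "(\<Sum>p\<in>Poly_Mapping.keys (u - v). of_int (Poly_Mapping.lookup (u - v) p) * G p) =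
    (\<Sum>p\<in>Poly_Mapping.keys u. of_int (Poly_Mapping.lookup u p) * G p) -
    (\<Sum>p\<in>Poly_Mapping.keys v. of_int (Poly_Mapping.lookup v p) * G p)"
proof -
  let ?K = "Poly_Mapping.keys u \<union> Poly_Mapping.keys v"
  have *: "(\<Sum>p\<in>Poly_Mapping.keys w. of_int (Poly_Mapping.lookup w p) * G p) =
      (\<Sum>p\<in>?K. of_int (Poly_Mapping.lookup w p) * G p)" if "Poly_Mapping.keys w \<subseteq> ?K" for w
    using that by (intro sum.mono_neutral_left) (auto simp: in_keys_iff)
  show ?thesis
    by (subst (1 2 3) *) (auto simp: keys_diff lookup_minus left_diff_distrib sum_subtractf)
qed

lemma tensor_form_frag_diff_left:
  "tensor_form_frag E H \<pi> (u - u') v = tensor_form_frag E H \<pi> u v - tensor_form_frag E H \<pi> u' v"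
  unfolding tensor_form_frag_alt by (rule frag_sum_diff)

lemma tensor_form_frag_diff_right:
  "tensor_form_frag E H \<pi> u (v - v') = tensor_form_frag E H \<pi> u v - tensor_form_frag E H \<pi> u v'"
  unfolding tensor_form_frag_alt frag_sum_diff by (simp add: right_diff_distrib sum_subtractf)

lemma tensor_form_frag_of:
  "tensor_form_frag E H \<pi> (frag_of (x, \<psi>)) (frag_of (y, \<phi>)) = ip H \<psi> (\<pi> (rip E x y) \<phi>)"
  unfolding tensor_form_frag_alt by simp

lemma (in pre_hilbert_space) ip_add_left:
  "x \<in> carrier H \<Longrightarrow> y \<in> carrier H \<Longrightarrow> z \<in> carrier H \<Longrightarrow>
    ip H (x \<oplus> y) z = ip H x z + ip H y z"
  using ip_add[of z x y] ip_hermitian[of "x \<oplus> y" z] ip_hermitian[of x z] ip_hermitian[of y z]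
  by simp

text \<open>Stated for differences because the induction rule for free abelian groups builds
  elements from 0 and generators by subtraction.\<close>

lemma free_group_hom_diff:
  assumes "abelian_group H" "h \<in> hom (free_Abelian_group S) (add_monoid H)"
    "Poly_Mapping.keys u \<subseteq> S" "Poly_Mapping.keys v \<subseteq> S"
  shows "h (u - v) = h u \<ominus>\<^bsub>H\<^esub> h v" "h u \<in> carrier H"
proof -
  interpret H: abelian_group H by fact
  interpret h: group_hom "free_Abelian_group S" "add_monoid H" h
    using assms(2) H.a_group by (auto simp: group_hom_def group_hom_axioms_def)
  show "h u \<in> carrier H"
    using h.hom_closed[of u] assms(3) by simp
  have "h (u - v) = h (u \<otimes>\<^bsub>free_Abelian_group S\<^esub> inv\<^bsub>free_Abelian_group S\<^esub> v)"
    using assms(4) by simp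
  also have "\<dots> = h u \<oplus>\<^bsub>H\<^esub> \<ominus>\<^bsub>H\<^esub> h v"
    using assms(3,4) h.hom_inv[of v] by (subst h.hom_mult) (auto simp: a_inv_def)
  finally show "h (u - v) = h u \<ominus>\<^bsub>H\<^esub> h v"
    by (simp add: H.minus_eq)
qed

text \<open>
  If \<open>\<langle>x, y\<rangle> = \<Sum>\<^sub>i g\<^sub>i(x)\<^sup>* g\<^sub>i(y)\<close> with right linear coordinates \<open>g\<^sub>i\<close>, then \<open>x \<otimes> \<psi> \<mapsto> (\<pi>(g\<^sub>i(x)) \<psi>)\<^sub>i\<close> is
  an isometry of \<open>E \<otimes>\<^sub>A H\<close> into a power of \<open>H\<close>.
\<close>

lemma (in star_algebra) condition_P_coordinates:
  fixes E :: "('r cx, 'a, 'e, 'k) inner_module_scheme" and g :: "'i \<Rightarrow> 'e \<Rightarrow> 'a"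
  assumes E: "\<And>x y. x \<in> carrier E \<Longrightarrow> y \<in> carrier E \<Longrightarrow> x \<oplus>\<^bsub>E\<^esub> y \<in> carrier E"
      "\<And>c x. x \<in> carrier E \<Longrightarrow> c \<odot>\<^bsub>E\<^esub> x \<in> carrier E"
      "\<And>x a. x \<in> carrier E \<Longrightarrow> a \<in> carrier A \<Longrightarrow> ract E x a \<in> carrier E"
    and I: "finite I"
    and g_closed: "\<And>i x. i \<in> I \<Longrightarrow> x \<in> carrier E \<Longrightarrow> g i x \<in> carrier A"
    and g_add: "\<And>i x y. i \<in> I \<Longrightarrow> x \<in> carrier E \<Longrightarrow> y \<in> carrier E \<Longrightarrow> g i (x \<oplus>\<^bsub>E\<^esub> y) = g i x \<oplus> g i y"
    and g_smult: "\<And>i c x. i \<in> I \<Longrightarrow> x \<in> carrier E \<Longrightarrow> g i (c \<odot>\<^bsub>E\<^esub> x) = c \<odot> g i x"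
    and g_ract: "\<And>i x a. i \<in> I \<Longrightarrow> x \<in> carrier E \<Longrightarrow> a \<in> carrier A \<Longrightarrow> g i (ract E x a) = g i x \<otimes> a"
    and rip: "\<And>x y. x \<in> carrier E \<Longrightarrow> y \<in> carrier E \<Longrightarrow>
                rip E x y = (\<Oplus>i\<in>I. star A (g i x) \<otimes> g i y)"
  shows "condition_P A E TYPE('h)"
  unfolding condition_P_def
proof (intro allI impI ballI, elim conjE)
  fix H :: "('r cx, 'h) prehilbert" and \<pi> U
  assume H: "pre_hilbert_space H" and \<pi>: "star_representation A H \<pi>"
    and U: "U \<in> carrier (tensor_product A E H \<pi>)"
  interpret H: pre_hilbert_space H by fact
  define S where "S = carrier E \<times> carrier H"
  define F where "F = free_Abelian_group S"
  have F: "group F" by (simp add: F_def)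
  have \<pi>_closed [simp]: "\<pi> a x \<in> carrier H" if "a \<in> carrier A" "x \<in> carrier H" for a x
    using \<pi> that unfolding star_representation_def by blast
  have \<pi>_simps: "b \<in> carrier A \<Longrightarrow> \<pi> (a \<oplus> b) x = \<pi> a x \<oplus>\<^bsub>H\<^esub> \<pi> b x"
    "y \<in> carrier H \<Longrightarrow> \<pi> a (x \<oplus>\<^bsub>H\<^esub> y) = \<pi> a x \<oplus>\<^bsub>H\<^esub> \<pi> a y"
    "\<pi> (c \<odot> a) x = c \<odot>\<^bsub>H\<^esub> \<pi> a x" "\<pi> a (c \<odot>\<^bsub>H\<^esub> x) = c \<odot>\<^bsub>H\<^esub> \<pi> a x"
    "b \<in> carrier A \<Longrightarrow> \<pi> (a \<otimes> b) x = \<pi> a (\<pi> b x)"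
    if "a \<in> carrier A" "x \<in> carrier H" for a b x y c
    using that \<pi> unfolding star_representation_def by blast+
  have \<pi>_star: "ip H x (\<pi> a y) = ip H (\<pi> (star A a) x) y"
    if "a \<in> carrier A" "x \<in> carrier H" "y \<in> carrier H" for a x y
    using that \<pi> unfolding star_representation_def by blast
  \<comment> \<open>The i-th component of the isometry, first on the free abelian group, by its
    universal property.\<close>
  have "\<exists>h \<in> hom F (add_monoid H). \<forall>x\<in>carrier E. \<forall>\<psi>\<in>carrier H. h (frag_of (x, \<psi>)) = \<pi> (g i x) \<psi>"
    if "i \<in> I" for i
  proof -
    have "(\<lambda>(x, \<psi>). \<pi> (g i x) \<psi>) ` S \<subseteq> carrier (add_monoid H)"
      using that by (auto simp: S_def g_closed)
    from comm_group.free_Abelian_group_universal[OF H.a_comm_group this] show ?thesis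
      by (metis (mono_tags, lifting) F_def S_def SigmaI case_prod_conv)
  qed
  then obtain h where h: "\<And>i. i \<in> I \<Longrightarrow> h i \<in> hom F (add_monoid H)"
    and h_frag: "\<And>i x \<psi>. i \<in> I \<Longrightarrow> x \<in> carrier E \<Longrightarrow> \<psi> \<in> carrier H \<Longrightarrow>
                   h i (frag_of (x, \<psi>)) = \<pi> (g i x) \<psi>"
    by metis
  have "abelian_group H"
    by unfold_locales
  note h_diff = free_group_hom_diff[OF this h[unfolded F_def]]
  \<comment> \<open>Both sides are biadditive, so a nested induction reduces the claim to
    generators. There \<open>rip\<close> is expanded, and the representation moves
    \<open>star A (g i x)\<close> into the left argument as \<open>g i x\<close>.\<close>
  have form: "tensor_form_frag E H \<pi> u v = (\<Sum>i\<in>I. ip H (h i u) (h i v))"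
    if u_keys: "Poly_Mapping.keys u \<subseteq> S" and v_keys: "Poly_Mapping.keys v \<subseteq> S" for u v
    using u_keys
  proof (induction u rule: free_Abelian_group_induct[consumes 1])
    case 1
    have "h i 0 = \<zero>\<^bsub>H\<^esub>" if "i \<in> I" for i
      using h_diff[OF that, of 0 0] by (simp add: H.minus_eq H.r_neg)
    moreover have "ip H \<zero>\<^bsub>H\<^esub> (h i v) = 0" if "i \<in> I" for i
      using H.ip_add_left[of "\<zero>\<^bsub>H\<^esub>" "\<zero>\<^bsub>H\<^esub>" "h i v"] h_diff(2)[OF that v_keys v_keys] by simp
    ultimately show ?case
      using tensor_form_frag_diff_left[of E H \<pi> 0 0 v] by simp
  next
    case (2 u u')
    have "ip H (h i (u - u')) (h i v) = ip H (h i u) (h i v) - ip H (h i u') (h i v)" if i: "i \<in> I" for i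
    proof -
      have "h i u = h i (u - u') \<oplus>\<^bsub>H\<^esub> h i u'"
        using h_diff[OF i 2(1,2)] h_diff(2)[OF i 2(2,2)] by (simp add: H.minus_eq H.a_assoc H.l_neg)
      moreover have "h i (u - u') \<in> carrier H"
        using h_diff[OF i 2(1,2)] h_diff(2)[OF i 2(2,2)] by (simp add: H.minus_eq)
      ultimately show ?thesis
        using h_diff(2)[OF i 2(2,2)] h_diff(2)[OF i v_keys v_keys]
        by (simp add: H.ip_add_left)
    qed
    with 2 show ?case
      by (simp add: tensor_form_frag_diff_left sum_subtractf)
  next
    case (3 p)
    obtain x \<psi> where p: "p = (x, \<psi>)" and x: "x \<in> carrier E" and \<psi>: "\<psi> \<in> carrier H"
      using 3 by (auto simp: S_def)
    from v_keys show ?case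
    proof (induction v rule: free_Abelian_group_induct[consumes 1])
      case 1
      have "h i 0 = \<zero>\<^bsub>H\<^esub>" if "i \<in> I" for i
        using h_diff[OF that, of 0 0] by (simp add: H.minus_eq H.r_neg)
      moreover have "ip H (h i (frag_of p)) \<zero>\<^bsub>H\<^esub> = 0" if "i \<in> I" for i
        using H.ip_add[of "h i (frag_of p)" "\<zero>\<^bsub>H\<^esub>" "\<zero>\<^bsub>H\<^esub>"] that p x \<psi> by (simp add: h_frag g_closed)
      ultimately show ?case
        using tensor_form_frag_diff_right[of E H \<pi> "frag_of p" 0 0] by simp
    next
      case (2 u u')
      have "ip H (h i (frag_of p)) (h i (u - u')) =
          ip H (h i (frag_of p)) (h i u) - ip H (h i (frag_of p)) (h i u')" if i: "i \<in> I" for i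
      proof -
        have "h i u = h i (u - u') \<oplus>\<^bsub>H\<^esub> h i u'"
          using h_diff[OF i 2(1,2)] h_diff(2)[OF i 2(2,2)] by (simp add: H.minus_eq H.a_assoc H.l_neg)
        moreover have "h i (u - u') \<in> carrier H"
          using h_diff[OF i 2(1,2)] h_diff(2)[OF i 2(2,2)] by (simp add: H.minus_eq)
        ultimately show ?thesis
          using h_diff(2)[OF i 2(2,2)] i p x \<psi> by (simp add: H.ip_add h_frag g_closed)
      qed
      with 2 show ?case
        by (simp add: tensor_form_frag_diff_right sum_subtractf)
    next
      case (3 q)
      then obtain y \<phi> where q: "q = (y, \<phi>)" and y: "y \<in> carrier E" and \<phi>: "\<phi> \<in> carrier H"
        by (auto simp: S_def)
      have "tensor_form_frag E H \<pi> (frag_of p) (frag_of q)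
          = ip H \<psi> (\<pi> (\<Oplus>i\<in>I. star A (g i x) \<otimes> g i y) \<phi>)"
        by (simp add: p q tensor_form_frag_of rip x y)
      also have "\<dots> = (\<Sum>i\<in>I. ip H \<psi> (\<pi> (star A (g i x) \<otimes> g i y) \<phi>))"
        using \<psi> \<phi> x y I g_closed \<pi>
        by (intro abelian_group.additive_finsum[OF abelian_group_carrier, of "\<lambda>a. ip H \<psi> (\<pi> a \<phi>)"])
          (auto simp: star_representation_def H.ip_add)
      also have "\<dots> = (\<Sum>i\<in>I. ip H (h i (frag_of p)) (h i (frag_of q)))"
      proof (rule sum.cong)
        fix i assume i: "i \<in> I"
        show "ip H \<psi> (\<pi> (star A (g i x) \<otimes> g i y) \<phi>) =
            ip H (h i (frag_of p)) (h i (frag_of q))"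
          using i x y \<phi> \<psi> by (simp add: p q h_frag g_closed \<pi>_simps(5) \<pi>_star)
      qed simp
      finally show ?case .
    qed
  qed
  define N where "N = generate F (tensor_relations A E H \<pi>)"
  have keys_diff_S: "Poly_Mapping.keys (a - b) \<subseteq> S" if "Poly_Mapping.keys a \<subseteq> S" "Poly_Mapping.keys b \<subseteq> S"
    for a b :: "'e \<times> 'h \<Rightarrow>\<^sub>0 int"
    using keys_diff[of a b] that by blast
  have S_iff: "(x, \<psi>) \<in> S \<longleftrightarrow> x \<in> carrier E \<and> \<psi> \<in> carrier H" for x \<psi>
    by (simp add: S_def)
  have relations: "tensor_relations A E H \<pi> \<subseteq> carrier F"
  proof
    show "n \<in> carrier F" if "n \<in> tensor_relations A E H \<pi>" for n
      using that E unfolding tensor_relations_def F_def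
      by (elim UnE CollectE exE conjE) (simp_all add: keys_diff_S S_iff)
  qed
  then have N_keys: "Poly_Mapping.keys n \<subseteq> S" if "n \<in> N" for n
    using subsetD[OF group.generate_incl[OF F relations], of n] that
    unfolding N_def F_def by simp
  \<comment> \<open>The four families of relations are killed because \<open>g i\<close> and \<pi>
    are linear; for A-balancedness, \<open>g_ract\<close> meets multiplicativity of \<pi>. The
    kernel is a subgroup, so it contains all of N and the map descends to the tensor
    product.\<close>
  have h_N: "h i n = \<zero>\<^bsub>H\<^esub>" if i: "i \<in> I" and n: "n \<in> N" for i n
  proof -
    interpret h: group_hom F "add_monoid H" "h i"
      using h[OF i] H.a_group F by (auto simp: group_hom_def group_hom_axioms_def)
    have h_diff_S: "h i (u - v) = h i u \<ominus>\<^bsub>H\<^esub> h i v" if "Poly_Mapping.keys u \<subseteq> S" "Poly_Mapping.keys v \<subseteq> S" for u v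
      using h_diff(1)[OF i that] .
    have cancel: "a \<oplus>\<^bsub>H\<^esub> b \<ominus>\<^bsub>H\<^esub> a \<ominus>\<^bsub>H\<^esub> b = \<zero>\<^bsub>H\<^esub>" "a \<ominus>\<^bsub>H\<^esub> a = \<zero>\<^bsub>H\<^esub>"
      if "a \<in> carrier H" "b \<in> carrier H" for a b
      using that H.a_comm[of a b] by (simp_all add: H.minus_eq H.a_assoc H.r_neg)
    have "h i n = \<zero>\<^bsub>H\<^esub>" if "n \<in> tensor_relations A E H \<pi>" for n
      using that i g_closed unfolding tensor_relations_def
    proof (elim UnE CollectE exE conjE)
      fix x y \<psi> assume n: "n = frag_of (x \<oplus>\<^bsub>E\<^esub> y, \<psi>) - frag_of (x, \<psi>) - frag_of (y, \<psi>)"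
        and *: "x \<in> carrier E" "y \<in> carrier E" "\<psi> \<in> carrier H"
      have "h i n = \<pi> (g i x \<oplus> g i y) \<psi> \<ominus>\<^bsub>H\<^esub> \<pi> (g i x) \<psi> \<ominus>\<^bsub>H\<^esub> \<pi> (g i y) \<psi>"
        using E(1)[of x y] i * by (simp add: n h_diff_S h_frag g_add keys_diff_S S_iff)
      then show ?thesis
        using i * by (simp add: \<pi>_simps(1) g_closed cancel)
    next
      fix x \<psi> \<phi> assume n: "n = frag_of (x, \<psi> \<oplus>\<^bsub>H\<^esub> \<phi>) - frag_of (x, \<psi>) - frag_of (x, \<phi>)"
        and *: "x \<in> carrier E" "\<psi> \<in> carrier H" "\<phi> \<in> carrier H"
      have "h i n = \<pi> (g i x) (\<psi> \<oplus>\<^bsub>H\<^esub> \<phi>) \<ominus>\<^bsub>H\<^esub> \<pi> (g i x) \<psi> \<ominus>\<^bsub>H\<^esub> \<pi> (g i x) \<phi>"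
        using i * by (simp add: n h_diff_S h_frag keys_diff_S S_iff)
      then show ?thesis
        using i * by (simp add: \<pi>_simps(2) g_closed cancel)
    next
      fix c x \<psi> assume n: "n = frag_of (c \<odot>\<^bsub>E\<^esub> x, \<psi>) - frag_of (x, c \<odot>\<^bsub>H\<^esub> \<psi>)"
        and *: "x \<in> carrier E" "\<psi> \<in> carrier H"
      have "h i n = \<pi> (c \<odot> g i x) \<psi> \<ominus>\<^bsub>H\<^esub> \<pi> (g i x) (c \<odot>\<^bsub>H\<^esub> \<psi>)"
        using E(2)[of x c] i * by (simp add: n h_diff_S h_frag g_smult S_iff)
      then show ?thesis
        using i * by (simp add: \<pi>_simps(3,4) g_closed cancel)
    next
      fix x a \<psi> assume n: "n = frag_of (ract E x a, \<psi>) - frag_of (x, \<pi> a \<psi>)"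
        and *: "x \<in> carrier E" "a \<in> carrier A" "\<psi> \<in> carrier H"
      have "h i n = \<pi> (g i x \<otimes> a) \<psi> \<ominus>\<^bsub>H\<^esub> \<pi> (g i x) (\<pi> a \<psi>)"
        using E(3)[of x a] i * by (simp add: n h_diff_S h_frag g_ract S_iff)
      then show ?thesis
        using i * by (simp add: \<pi>_simps(5) g_closed cancel)
    qed
    with relations have "tensor_relations A E H \<pi> \<subseteq> {n \<in> carrier F. h i n = \<one>\<^bsub>add_monoid H\<^esub>}"
      by auto
    moreover have "subgroup {n \<in> carrier F. h i n = \<one>\<^bsub>add_monoid H\<^esub>} F"
      using h.subgroup_kernel by (simp add: kernel_def)
    ultimately have "N \<subseteq> {n \<in> carrier F. h i n = \<one>\<^bsub>add_monoid H\<^esub>}"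
      unfolding N_def by (rule group.generate_subgroup_incl[OF F])
    with n show ?thesis by (auto simp: F_def)
  qed
  obtain u where u: "Poly_Mapping.keys u \<subseteq> S" and U_eq: "U = N #>\<^bsub>F\<^esub> u"
    using U by (auto simp: tensor_product_def FactGroup_def RCOSETS_def F_def N_def S_def)
  have U_cases: "\<exists>n\<in>N. v = n + u" if "v \<in> U" for v
    using that by (auto simp: U_eq r_coset_def F_def)
  have "0 \<in> N"
    using generate.one[of F "tensor_relations A E H \<pi>"] by (simp add: N_def F_def)
  then have "u \<in> U"
    by (force simp: U_eq r_coset_def F_def)
  have h_U: "h i v = h i u" if v: "v \<in> U" and i: "i \<in> I" for i v
  proof -
    obtain n where n: "n \<in> N" "v = n + u"
      using U_cases[OF v] by blast
    have "h i v = h i n \<oplus>\<^bsub>H\<^esub> h i u"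
      using n u N_keys[OF n(1)] hom_mult[OF h[OF i], of n u] by (simp add: F_def)
    then show ?thesis
      using n i h_diff(2)[OF i u u] by (simp add: h_N)
  qed
  have U_keys: "Poly_Mapping.keys v \<subseteq> S" if v: "v \<in> U" for v
    using U_cases[OF v] N_keys u keys_add by fastforce
  \<comment> \<open>\<open>tensor_form\<close> is a definite description over all pairs of
    representatives. All of them have the same image under \<open>h i\<close>, so the value is
    constant and the description is met.\<close>
  have "tensor_form_frag E H \<pi> v w = (\<Sum>i\<in>I. ip H (h i u) (h i u))" if "v \<in> U" "w \<in> U" for v w
    using that by (simp add: form U_keys h_U)
  with \<open>u \<in> U\<close> have "tensor_form E H \<pi> U U = (\<Sum>i\<in>I. ip H (h i u) (h i u))"
    unfolding tensor_form_def by (intro the_equality) (blast, metis)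
  also have "cx_nonneg \<dots>"
    using h_diff(2)[OF _ u u] by (intro cx_nonneg_sum H.ip_nonneg)
  finally show "cx_nonneg (tensor_form E H \<pi> U U)" .
qed

section \<open>The module of a projection\<close>

context star_algebra
begin

lemma semiring_carrier: "semiring A"
  by unfold_locales

lemma abelian_monoid_carrier: "abelian_monoid A"
  by unfold_locales

lemma
  fixes f g :: "'i::finite \<Rightarrow> 'a"
  assumes "\<And>i. f i \<in> carrier A"
  shows sum_closed [simp, intro]: "(\<Oplus>i\<in>UNIV. f i) \<in> carrier A"
    and sum_mult_left: "a \<in> carrier A \<Longrightarrow> (\<Oplus>i\<in>UNIV. f i) \<otimes> a = (\<Oplus>i\<in>UNIV. f i \<otimes> a)"
    and sum_mult_right: "a \<in> carrier A \<Longrightarrow> a \<otimes> (\<Oplus>i\<in>UNIV. f i) = (\<Oplus>i\<in>UNIV. a \<otimes> f i)"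
    and sum_smult: "c \<odot> (\<Oplus>i\<in>UNIV. f i) = (\<Oplus>i\<in>UNIV. c \<odot> f i)"
    and sum_star: "star A (\<Oplus>i\<in>UNIV. f i) = (\<Oplus>i\<in>UNIV. star A (f i))"
    and sum_add: "(\<And>i. g i \<in> carrier A) \<Longrightarrow> (\<Oplus>i\<in>UNIV. f i \<oplus> g i) = (\<Oplus>i\<in>UNIV. f i) \<oplus> (\<Oplus>i\<in>UNIV. g i)"
proof -
  have *: "f \<in> UNIV \<rightarrow> carrier A"
    using assms by simp
  show "(\<Oplus>i\<in>UNIV. f i) \<in> carrier A"
    using * by (rule abelian_monoid.finsum_closed[OF abelian_monoid_carrier])
  show "a \<in> carrier A \<Longrightarrow> (\<Oplus>i\<in>UNIV. f i) \<otimes> a = (\<Oplus>i\<in>UNIV. f i \<otimes> a)"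
    using * by (intro semiring.finsum_ldistr[OF semiring_carrier]) auto
  show "a \<in> carrier A \<Longrightarrow> a \<otimes> (\<Oplus>i\<in>UNIV. f i) = (\<Oplus>i\<in>UNIV. a \<otimes> f i)"
    using * by (intro semiring.finsum_rdistr[OF semiring_carrier]) auto
  show "c \<odot> (\<Oplus>i\<in>UNIV. f i) = (\<Oplus>i\<in>UNIV. c \<odot> f i)"
    using * by (intro finsum_smult_ldistr) auto
  show "star A (\<Oplus>i\<in>UNIV. f i) = (\<Oplus>i\<in>UNIV. star A (f i))"
    using * by (intro star_finsum) auto
  show "(\<And>i. g i \<in> carrier A) \<Longrightarrow> (\<Oplus>i\<in>UNIV. f i \<oplus> g i) = (\<Oplus>i\<in>UNIV. f i) \<oplus> (\<Oplus>i\<in>UNIV. g i)"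
    using * by (intro abelian_monoid.finsum_addf[OF abelian_monoid_carrier]) auto
qed

lemma sum_swap:
  fixes f :: "'i::finite \<Rightarrow> 'j::finite \<Rightarrow> 'a"
  assumes "\<And>i j. f i j \<in> carrier A"
  shows "(\<Oplus>i\<in>UNIV. \<Oplus>j\<in>UNIV. f i j) = (\<Oplus>j\<in>UNIV. \<Oplus>i\<in>UNIV. f i j)"
  using assms by (intro abelian_monoid.finsum_swap[OF abelian_monoid_carrier]) auto

lemmas A_assoc = monoid.m_assoc[OF monoid_carrier]
lemmas A_l_distr = semiring.l_distr[OF semiring_carrier]
lemmas A_r_distr = semiring.r_distr[OF semiring_carrier]
lemmas A_a_assoc = abelian_monoid.a_assoc[OF abelian_monoid_carrier]
lemmas A_a_comm = abelian_monoid.a_comm[OF abelian_monoid_carrier]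
lemmas A_a_ac = A_a_assoc A_a_comm abelian_monoid.a_lcomm[OF abelian_monoid_carrier]

lemma
  fixes L :: "'n::finite \<Rightarrow> 'n \<Rightarrow> 'a" and v w :: "'n \<Rightarrow> 'a"
  assumes L: "\<And>i j. L i j \<in> carrier A" and v: "\<And>i. v i \<in> carrier A"
  shows matrix_vector_closed [simp, intro]: "matrix_vector A L v i \<in> carrier A"
    and matrix_vector_add: "(\<And>i. w i \<in> carrier A) \<Longrightarrow>
          matrix_vector A L (\<lambda>i. v i \<oplus> w i) = (\<lambda>i. matrix_vector A L v i \<oplus> matrix_vector A L w i)"
    and matrix_vector_smult: "matrix_vector A L (\<lambda>i. c \<odot> v i) = (\<lambda>i. c \<odot> matrix_vector A L v i)"
    and matrix_vector_mult: "a \<in> carrier A \<Longrightarrow>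
          matrix_vector A L (\<lambda>i. v i \<otimes> a) = (\<lambda>i. matrix_vector A L v i \<otimes> a)"
proof -
  show "matrix_vector A L v i \<in> carrier A"
    using L v by (simp add: matrix_vector_def)
  show "matrix_vector A L (\<lambda>i. v i \<oplus> w i) = (\<lambda>i. matrix_vector A L v i \<oplus> matrix_vector A L w i)"
    if "\<And>i. w i \<in> carrier A"
    using that L v by (simp add: matrix_vector_def A_r_distr sum_add)
  show "matrix_vector A L (\<lambda>i. c \<odot> v i) = (\<lambda>i. c \<odot> matrix_vector A L v i)"
    using L v by (simp add: matrix_vector_def smult_mult_right sum_smult)
  show "matrix_vector A L (\<lambda>i. v i \<otimes> a) = (\<lambda>i. matrix_vector A L v i \<otimes> a)" if "a \<in> carrier A"
    using that L v by (simp add: matrix_vector_def sum_mult_left A_assoc)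
qed

lemma matrix_mult_entry: "(K \<otimes>\<^bsub>matrix_algebra A\<^esub> L) i j = matrix_vector A K (\<lambda>k. L k j) i"
  by (simp add: matrix_algebra_def matrix_vector_def)

lemma matrix_carrier: "L \<in> carrier (matrix_algebra A) \<longleftrightarrow> (\<forall>i j. L i j \<in> carrier A)"
  by (simp add: matrix_algebra_def)

lemma matrix_vector_matrix_vector:
  fixes K L :: "'n::finite \<Rightarrow> 'n \<Rightarrow> 'a"
  assumes "\<And>i j. K i j \<in> carrier A" "\<And>i j. L i j \<in> carrier A" "\<And>i. v i \<in> carrier A"
  shows "matrix_vector A K (matrix_vector A L v) = matrix_vector A (K \<otimes>\<^bsub>matrix_algebra A\<^esub> L) v"
proof
  fix i
  have "matrix_vector A K (matrix_vector A L v) i = (\<Oplus>k\<in>UNIV. \<Oplus>l\<in>UNIV. K i k \<otimes> L k l \<otimes> v l)"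
    using assms by (simp add: matrix_vector_def sum_mult_right A_assoc)
  also have "\<dots> = (\<Oplus>l\<in>UNIV. \<Oplus>k\<in>UNIV. K i k \<otimes> L k l \<otimes> v l)"
    using assms by (intro sum_swap) auto
  also have "\<dots> = matrix_vector A (K \<otimes>\<^bsub>matrix_algebra A\<^esub> L) v i"
    using assms by (simp add: matrix_vector_def matrix_algebra_def sum_mult_left)
  finally show "matrix_vector A K (matrix_vector A L v) i = matrix_vector A (K \<otimes>\<^bsub>matrix_algebra A\<^esub> L) v i" .
qed

lemma matrix_mult_assoc:
  fixes K L M :: "'n::finite \<Rightarrow> 'n \<Rightarrow> 'a"
  assumes "\<And>i j. K i j \<in> carrier A" "\<And>i j. L i j \<in> carrier A" "\<And>i j. M i j \<in> carrier A"
  shows "K \<otimes>\<^bsub>matrix_algebra A\<^esub> L \<otimes>\<^bsub>matrix_algebra A\<^esub> M = K \<otimes>\<^bsub>matrix_algebra A\<^esub> (L \<otimes>\<^bsub>matrix_algebra A\<^esub> M)"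
  using assms
  by (intro ext) (simp add: matrix_mult_entry matrix_vector_matrix_vector[symmetric])

lemma matrix_mult_star:
  fixes K L :: "'n::finite \<Rightarrow> 'n \<Rightarrow> 'a"
  assumes "\<And>i j. K i j \<in> carrier A" "\<And>i j. L i j \<in> carrier A"
  shows "star (matrix_algebra A) (K \<otimes>\<^bsub>matrix_algebra A\<^esub> L) =
    star (matrix_algebra A) L \<otimes>\<^bsub>matrix_algebra A\<^esub> star (matrix_algebra A) K"
  using assms by (intro ext) (simp add: matrix_algebra_def sum_star star_mult)

text \<open>The inner product of the whole free module A^n. The field \<open>rip\<close> of the
  bimodule is the same function, so its rules can be proved before any projection is fixed.\<close>

definition vector_ip :: "('n::finite \<Rightarrow> 'a) \<Rightarrow> ('n \<Rightarrow> 'a) \<Rightarrow> 'a" where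
  "vector_ip v w = (\<Oplus>i\<in>UNIV. star A (v i) \<otimes> w i)"

lemma
  fixes v w u :: "'n::finite \<Rightarrow> 'a"
  assumes "\<And>i. v i \<in> carrier A" "\<And>i. w i \<in> carrier A"
  shows vector_ip_closed [simp, intro]: "vector_ip v w \<in> carrier A"
    and vector_ip_star: "star A (vector_ip v w) = vector_ip w v"
    and vector_ip_add: "(\<And>i. u i \<in> carrier A) \<Longrightarrow>
          vector_ip v (\<lambda>i. w i \<oplus> u i) = vector_ip v w \<oplus> vector_ip v u"
    and vector_ip_smult: "vector_ip v (\<lambda>i. c \<odot> w i) = c \<odot> vector_ip v w"
    and vector_ip_mult: "a \<in> carrier A \<Longrightarrow> vector_ip v (\<lambda>i. w i \<otimes> a) = vector_ip v w \<otimes> a"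
    and vector_ip_mult_left: "a \<in> carrier A \<Longrightarrow> vector_ip (\<lambda>i. v i \<otimes> a) w = star A a \<otimes> vector_ip v w"
proof -
  show "vector_ip v w \<in> carrier A"
    using assms by (simp add: vector_ip_def)
  show "star A (vector_ip v w) = vector_ip w v"
    using assms by (simp add: vector_ip_def sum_star star_mult)
  show "vector_ip v (\<lambda>i. w i \<oplus> u i) = vector_ip v w \<oplus> vector_ip v u" if "\<And>i. u i \<in> carrier A"
    using that assms by (simp add: vector_ip_def A_r_distr sum_add)
  show "vector_ip v (\<lambda>i. c \<odot> w i) = c \<odot> vector_ip v w"
    using assms by (simp add: vector_ip_def smult_mult_right sum_smult)
  show "vector_ip v (\<lambda>i. w i \<otimes> a) = vector_ip v w \<otimes> a" if "a \<in> carrier A"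
    using that assms by (simp add: vector_ip_def sum_mult_left A_assoc)
  show "vector_ip (\<lambda>i. v i \<otimes> a) w = star A a \<otimes> vector_ip v w" if "a \<in> carrier A"
    using that assms by (simp add: vector_ip_def sum_mult_right A_assoc star_mult)
qed

lemma
  fixes v w u :: "'n::finite \<Rightarrow> 'a"
  assumes "\<And>i. v i \<in> carrier A" "\<And>i. w i \<in> carrier A"
  shows vector_ip_add_left: "(\<And>i. u i \<in> carrier A) \<Longrightarrow>
          vector_ip (\<lambda>i. v i \<oplus> u i) w = vector_ip v w \<oplus> vector_ip u w"
    and vector_ip_smult_left: "vector_ip (\<lambda>i. c \<odot> v i) w = cx_cnj c \<odot> vector_ip v w"
proof -
  show "vector_ip (\<lambda>i. v i \<oplus> u i) w = vector_ip v w \<oplus> vector_ip u w" if "\<And>i. u i \<in> carrier A"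
    using that assms by (simp add: vector_ip_def star_add A_l_distr sum_add)
  show "vector_ip (\<lambda>i. c \<odot> v i) w = cx_cnj c \<odot> vector_ip v w"
    using assms by (simp add: vector_ip_def star_smult smult_mult_left sum_smult)
qed

text \<open>Exchanging the two sums leaves starred and transposed entries, which are those of
  \<open>star (matrix_algebra A) L\<close>. Every adjoint of an endomorphism comes from
  here.\<close>

lemma vector_ip_adjoint:
  fixes L :: "'n::finite \<Rightarrow> 'n \<Rightarrow> 'a"
  assumes "\<And>i j. L i j \<in> carrier A" "\<And>i. v i \<in> carrier A" "\<And>i. w i \<in> carrier A"
  shows "vector_ip v (matrix_vector A L w) = vector_ip (matrix_vector A (star (matrix_algebra A) L) v) w"
proof -
  have "vector_ip v (matrix_vector A L w) = (\<Oplus>i\<in>UNIV. \<Oplus>j\<in>UNIV. star A (v i) \<otimes> L i j \<otimes> w j)"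
    using assms by (simp add: vector_ip_def matrix_vector_def sum_mult_right A_assoc)
  also have "\<dots> = (\<Oplus>j\<in>UNIV. \<Oplus>i\<in>UNIV. star A (v i) \<otimes> L i j \<otimes> w j)"
    using assms by (intro sum_swap) auto
  also have "\<dots> = vector_ip (matrix_vector A (star (matrix_algebra A) L) v) w"
    using assms
    by (simp add: vector_ip_def matrix_vector_def matrix_algebra_def sum_star star_mult sum_mult_left)
  finally show ?thesis .
qed

end

section \<open>The module P A^n and its generating columns\<close>

locale projection_module = star_algebra A
  for A :: "('r::linordered_idom cx, 'a, 'm) star_alg_scheme" (structure) +
  fixes P :: "'n::finite \<Rightarrow> 'n \<Rightarrow> 'a"
  assumes projection: "projection (matrix_algebra A) P"
begin

abbreviation "E \<equiv> projective_bimodule A P"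
abbreviation "B \<equiv> End_algebra A E"
abbreviation "C \<equiv> corner_algebra (matrix_algebra A) P"

lemma P_closed [simp, intro]: "P i j \<in> carrier A"
  using projection by (simp add: projection_def matrix_carrier)

lemma P_star: "star (matrix_algebra A) P = P" and P_idem: "P \<otimes>\<^bsub>matrix_algebra A\<^esub> P = P"
  using projection by (simp_all add: projection_def)

lemma star_P [simp]: "star A (P i j) = P j i"
  using fun_cong[OF fun_cong[OF P_star, of j], of i] by (simp add: matrix_algebra_def)

lemma lip_E: "lip E = (\<lambda>x y. \<lambda>z\<in>carrier E. (\<lambda>i. x i \<otimes> vector_ip y z))"
  by (simp add: projective_bimodule_def projective_module_def Let_def inner_module.defs
      inner_bimodule.defs vector_ip_def fun_eq_iff)

lemma E_simps [simp]:
  "add E = (\<lambda>x y i. x i \<oplus> y i)" "zero E = (\<lambda>i. \<zero>)" "module.smult E = (\<lambda>c x i. c \<odot> x i)"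
  "ract E = (\<lambda>x a i. x i \<otimes> a)" "rip E = vector_ip" "lact E = (\<lambda>T x. T x)"
  by (simp_all add: projective_bimodule_def projective_module_def Let_def inner_module.defs
      inner_bimodule.defs vector_ip_def fun_eq_iff)

text \<open>The image of an idempotent is its set of fixed vectors. Membership becomes an equation,
  which linear operations preserve.\<close>

lemma E_carrier: "x \<in> carrier E \<longleftrightarrow> (\<forall>i. x i \<in> carrier A) \<and> matrix_vector A P x = x"
proof -
  have "carrier E = matrix_vector A P ` {v. \<forall>i. v i \<in> carrier A}"
    by (simp add: projective_bimodule_def projective_module_def Let_def inner_module.defs
      inner_bimodule.defs)
  moreover have "matrix_vector A P (matrix_vector A P v) = matrix_vector A P v" if "\<forall>i. v i \<in> carrier A" for v
    using that by (simp add: matrix_vector_matrix_vector P_idem)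
  ultimately show ?thesis
    by (auto simp: image_iff) metis
qed

lemma E_entry [simp]: "x \<in> carrier E \<Longrightarrow> x i \<in> carrier A"
  by (simp add: E_carrier)

lemma
  assumes "x \<in> carrier E"
  shows E_add_closed [simp]: "y \<in> carrier E \<Longrightarrow> (\<lambda>i. x i \<oplus> y i) \<in> carrier E"
    and E_smult_closed [simp]: "(\<lambda>i. c \<odot> x i) \<in> carrier E"
    and E_ract_closed [simp]: "a \<in> carrier A \<Longrightarrow> (\<lambda>i. x i \<otimes> a) \<in> carrier E"
  using assms by (simp_all add: E_carrier matrix_vector_add matrix_vector_smult matrix_vector_mult)

lemma E_zero_closed [simp]: "(\<lambda>i. \<zero>) \<in> carrier E"
  by (simp add: E_carrier matrix_vector_def ring.ring_simprules[OF ring_carrier])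

lemma E_abelian_group: "abelian_group E"
proof (rule abelian_groupI)
  show "\<exists>y\<in>carrier E. y \<oplus>\<^bsub>E\<^esub> x = \<zero>\<^bsub>E\<^esub>" if "x \<in> carrier E" for x
  proof
    \<comment> \<open>Negation is taken as multiplication by the scalar -1, for which closure is
      already known.\<close>
    show "(\<lambda>i. (- 1) \<odot> x i) \<in> carrier E" using that by simp
    have "(- 1) \<odot> a \<oplus> a = \<zero>" if "a \<in> carrier A" for a
      using smult_add_left[OF that, of "-1" 1] that by simp
    with that show "(\<lambda>i. (- 1) \<odot> x i) \<oplus>\<^bsub>E\<^esub> x = \<zero>\<^bsub>E\<^esub>" by simp
  qed
qed (auto simp: A_a_ac)

lemma E_module: "module scalars E"
  by (rule moduleI[OF cring_scalars E_abelian_group])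
    (auto simp: smult_add_left smult_add_right smult_assoc)

text \<open>The image P e_j of the j-th unit vector, which itself need not lie in
  \<open>E\<close>.\<close>

definition column :: "'n \<Rightarrow> 'n \<Rightarrow> 'a" where
  "column j = (\<lambda>i. P i j)"

lemma column_closed [simp]: "column j \<in> carrier E"
  using P_idem by (auto simp: E_carrier column_def fun_eq_iff matrix_mult_entry)

text \<open>As P is Hermitian, the left side is the j-th entry of P x = x. Together with
  \<open>column_expansion\<close> this makes the columns a generating family that is its own
  dual.\<close>

lemma column_ip: "x \<in> carrier E \<Longrightarrow> vector_ip (column j) x = x j"
proof -
  assume "x \<in> carrier E"
  then have "matrix_vector A P x j = x j"
    by (simp add: E_carrier)
  then show ?thesis
    by (simp add: matrix_vector_def vector_ip_def column_def)
qed

lemma finsum_E: "finite I \<Longrightarrow> f \<in> I \<rightarrow> carrier E \<Longrightarrow> finsum E f I i = (\<Oplus>j\<in>I. f j i)"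
  by (rule abelian_group.additive_map_finsum[OF E_abelian_group abelian_group_carrier, of "\<lambda>x. x i"]) auto

text \<open>This is P x = x read column by column. An endomorphism is hence determined by its values
  on the columns.\<close>

lemma column_expansion:
  assumes "x \<in> carrier E"
  shows "(\<Oplus>\<^bsub>E\<^esub>j\<in>UNIV. ract E (column j) (x j)) = x"
proof
  fix i
  have "(\<Oplus>\<^bsub>E\<^esub>j\<in>UNIV. ract E (column j) (x j)) i = (\<Oplus>j\<in>UNIV. ract E (column j) (x j) i)"
    using assms by (intro finsum_E) auto
  also have "\<dots> = matrix_vector A P x i"
    by (simp add: column_def matrix_vector_def)
  also have "\<dots> = x i"
    using assms by (simp add: E_carrier)
  finally show "(\<Oplus>\<^bsub>E\<^esub>j\<in>UNIV. ract E (column j) (x j)) i = x i" .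
qed

text \<open>Testing against \<open>column j\<close> yields the star of the j-th entry. This is the
  nondegeneracy that makes adjoints unique.\<close>

lemma E_eqI: "x \<in> carrier E \<Longrightarrow> y \<in> carrier E \<Longrightarrow>
    (\<And>z. z \<in> carrier E \<Longrightarrow> vector_ip x z = vector_ip y z) \<Longrightarrow> x = y"
proof
  fix j assume xy: "x \<in> carrier E" "y \<in> carrier E"
    and eq: "\<And>z. z \<in> carrier E \<Longrightarrow> vector_ip x z = vector_ip y z"
  have "star A (vector_ip x (column j)) = star A (vector_ip y (column j))"
    using eq[of "column j"] by simp
  with xy show "x j = y j"
    by (simp add: vector_ip_star column_ip)
qed

section \<open>Endomorphisms and their identification with the corner P M_n P\<close>

lemma B_carrier: "T \<in> carrier B \<longleftrightarrow> T \<in> carrier E \<rightarrow>\<^sub>E carrier E \<and>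
    (\<forall>x\<in>carrier E. \<forall>y\<in>carrier E. T (\<lambda>i. x i \<oplus> y i) = (\<lambda>i. T x i \<oplus> T y i)) \<and>
    (\<forall>c. \<forall>x\<in>carrier E. T (\<lambda>i. c \<odot> x i) = (\<lambda>i. c \<odot> T x i)) \<and>
    (\<forall>x\<in>carrier E. \<forall>a\<in>carrier A. T (\<lambda>i. x i \<otimes> a) = (\<lambda>i. T x i \<otimes> a))"
  by (simp add: End_algebra_def module_endos_def)

lemma
  assumes "T \<in> carrier B" "x \<in> carrier E"
  shows B_closed [simp]: "T x \<in> carrier E"
    and B_add: "y \<in> carrier E \<Longrightarrow> T (\<lambda>i. x i \<oplus> y i) = (\<lambda>i. T x i \<oplus> T y i)"
    and B_smult: "T (\<lambda>i. c \<odot> x i) = (\<lambda>i. c \<odot> T x i)"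
    and B_ract: "a \<in> carrier A \<Longrightarrow> T (\<lambda>i. x i \<otimes> a) = (\<lambda>i. T x i \<otimes> a)"
  using assms by (auto simp: B_carrier)

lemma B_eqI: "S \<in> carrier B \<Longrightarrow> T \<in> carrier B \<Longrightarrow> (\<And>x. x \<in> carrier E \<Longrightarrow> S x = T x) \<Longrightarrow> S = T"
  by (rule extensionalityI[of _ "carrier E"]) (auto simp: B_carrier PiE_iff)

lemma B_simps [simp]:
  "monoid.mult B = compose (carrier E)" "one B = (\<lambda>x\<in>carrier E. x)" "zero B = (\<lambda>x\<in>carrier E. (\<lambda>i. \<zero>))"
  "add B = (\<lambda>S T. \<lambda>x\<in>carrier E. (\<lambda>i. S x i \<oplus> T x i))"
  "module.smult B = (\<lambda>c T. \<lambda>x\<in>carrier E. (\<lambda>i. c \<odot> T x i))"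
  by (simp_all add: End_algebra_def fun_eq_iff)

lemma B_add_closed: "S \<in> carrier B \<Longrightarrow> T \<in> carrier B \<Longrightarrow> S \<oplus>\<^bsub>B\<^esub> T \<in> carrier B"
  by (subst B_carrier) (auto simp: B_add B_smult B_ract smult_add_right A_a_ac A_l_distr)

lemma B_smult_closed: "T \<in> carrier B \<Longrightarrow> c \<odot>\<^bsub>B\<^esub> T \<in> carrier B"
  by (subst B_carrier)
    (auto simp: B_add B_smult B_ract smult_add_right smult_mult_left mult.commute simp flip: smult_assoc)

lemma B_mult_closed: "S \<in> carrier B \<Longrightarrow> T \<in> carrier B \<Longrightarrow> S \<otimes>\<^bsub>B\<^esub> T \<in> carrier B"
  by (subst B_carrier) (auto simp: B_add B_smult B_ract compose_def)

lemma B_one_closed: "\<one>\<^bsub>B\<^esub> \<in> carrier B"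
  by (subst B_carrier) auto

lemma B_zero_closed: "\<zero>\<^bsub>B\<^esub> \<in> carrier B"
  by (subst B_carrier) (auto simp: A_a_ac)

text \<open>The equation P L = L places the values of the operator in \<open>E\<close>.\<close>

lemma matrix_vector_B:
  fixes L :: "'n \<Rightarrow> 'n \<Rightarrow> 'a"
  assumes "\<And>i j. L i j \<in> carrier A" "P \<otimes>\<^bsub>matrix_algebra A\<^esub> L = L"
  shows "(\<lambda>x\<in>carrier E. matrix_vector A L x) \<in> carrier B"
  using assms
  by (subst B_carrier)
    (auto simp: E_carrier matrix_vector_matrix_vector matrix_vector_add matrix_vector_smult matrix_vector_mult)

lemma B_expansion:
  assumes T: "T \<in> carrier B" and x: "x \<in> carrier E"
  shows "T x = (\<Oplus>\<^bsub>E\<^esub>j\<in>UNIV. ract E (T (column j)) (x j))"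
proof -
  have "T x = T (\<Oplus>\<^bsub>E\<^esub>j\<in>UNIV. ract E (column j) (x j))"
    using x by (simp only: column_expansion)
  also have "\<dots> = (\<Oplus>\<^bsub>E\<^esub>j\<in>UNIV. T (ract E (column j) (x j)))"
    using T x by (intro abelian_group.additive_map_finsum[OF E_abelian_group E_abelian_group])
      (auto simp: B_add)
  finally show ?thesis
    using T x by (simp add: B_ract)
qed

text \<open>Idempotency of P turns the image of K \<mapsto> P K P into two equations. The left one
  governs the range of the operator, the right one its recovery from the columns.\<close>

lemma C_carrier: "L \<in> carrier C \<longleftrightarrow> (\<forall>i j. L i j \<in> carrier A) \<and>
    P \<otimes>\<^bsub>matrix_algebra A\<^esub> L = L \<and> L \<otimes>\<^bsub>matrix_algebra A\<^esub> P = L"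
proof
  assume "L \<in> carrier C"
  then obtain K where "K \<in> carrier (matrix_algebra A)"
    and L: "L = P \<otimes>\<^bsub>matrix_algebra A\<^esub> K \<otimes>\<^bsub>matrix_algebra A\<^esub> P"
    by (auto simp: corner_algebra_def)
  then have K: "K i j \<in> carrier A" for i j
    by (simp add: matrix_carrier)
  have closed: "(M \<otimes>\<^bsub>matrix_algebra A\<^esub> N) i j \<in> carrier A"
    if "\<And>i j. M i j \<in> carrier A" "\<And>i j. N i j \<in> carrier A" for M N :: "'n \<Rightarrow> 'n \<Rightarrow> 'a" and i j
    using that by (simp add: matrix_mult_entry)
  have "P \<otimes>\<^bsub>matrix_algebra A\<^esub> L = P \<otimes>\<^bsub>matrix_algebra A\<^esub> P \<otimes>\<^bsub>matrix_algebra A\<^esub> K \<otimes>\<^bsub>matrix_algebra A\<^esub> P"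
    unfolding L using K by (simp add: matrix_mult_assoc closed)
  moreover have "L \<otimes>\<^bsub>matrix_algebra A\<^esub> P = P \<otimes>\<^bsub>matrix_algebra A\<^esub> K \<otimes>\<^bsub>matrix_algebra A\<^esub> (P \<otimes>\<^bsub>matrix_algebra A\<^esub> P)"
    unfolding L using K by (simp add: matrix_mult_assoc closed)
  ultimately show "(\<forall>i j. L i j \<in> carrier A) \<and>
      P \<otimes>\<^bsub>matrix_algebra A\<^esub> L = L \<and> L \<otimes>\<^bsub>matrix_algebra A\<^esub> P = L"
    using K by (simp add: P_idem L[symmetric]) (simp add: L closed)
next
  assume L: "(\<forall>i j. L i j \<in> carrier A) \<and>
    P \<otimes>\<^bsub>matrix_algebra A\<^esub> L = L \<and> L \<otimes>\<^bsub>matrix_algebra A\<^esub> P = L"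
  then have "L = P \<otimes>\<^bsub>matrix_algebra A\<^esub> L \<otimes>\<^bsub>matrix_algebra A\<^esub> P"
    by simp
  moreover have "L \<in> carrier (matrix_algebra A)"
    using L by (simp add: matrix_carrier)
  ultimately show "L \<in> carrier C"
    unfolding corner_algebra_def by auto
qed

lemma C_simps [simp]:
  "monoid.mult C = monoid.mult (matrix_algebra A)" "one C = P" "star C = star (matrix_algebra A)"
  "add C = (\<lambda>K L i j. K i j \<oplus> L i j)" "module.smult C = (\<lambda>c L i j. c \<odot> L i j)"
  by (simp_all add: corner_algebra_def matrix_algebra_def)

definition operator_of :: "('n \<Rightarrow> 'n \<Rightarrow> 'a) \<Rightarrow> ('n \<Rightarrow> 'a) \<Rightarrow> 'n \<Rightarrow> 'a" where
  "operator_of L = (\<lambda>x\<in>carrier E. matrix_vector A L x)"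

text \<open>An endomorphism is defined on \<open>E\<close> only, so its matrix is read off from the
  projected unit vectors.\<close>

definition matrix_of :: "(('n \<Rightarrow> 'a) \<Rightarrow> 'n \<Rightarrow> 'a) \<Rightarrow> 'n \<Rightarrow> 'n \<Rightarrow> 'a" where
  "matrix_of T = (\<lambda>i j. T (column j) i)"

lemma operator_of_closed: "L \<in> carrier C \<Longrightarrow> operator_of L \<in> carrier B"
  unfolding operator_of_def by (rule matrix_vector_B) (simp_all add: C_carrier)

text \<open>Multiplication by P on the left fixes the matrix because T has values in
  \<open>E\<close>. On the right, the entries P k j are the coordinates of \<open>column j\<close>,
  and A-linearity expands \<open>T (column j)\<close> accordingly.\<close>

lemma matrix_of_closed:
  assumes T: "T \<in> carrier B"
  shows "matrix_of T \<in> carrier C"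
proof -
  have "(P \<otimes>\<^bsub>matrix_algebra A\<^esub> matrix_of T) i j = matrix_of T i j" for i j
    using B_closed[OF T column_closed[of j]] by (simp add: matrix_mult_entry matrix_of_def E_carrier)
  moreover have "(matrix_of T \<otimes>\<^bsub>matrix_algebra A\<^esub> P) i j = matrix_of T i j" for i j
  proof -
    have "T (column j) i = (\<Oplus>k\<in>UNIV. ract E (T (column k)) (column j k) i)"
      using T by (subst B_expansion[OF T], simp) (intro finsum_E, auto)
    then show ?thesis
      by (simp add: matrix_mult_entry matrix_of_def matrix_vector_def column_def)
  qed
  ultimately show ?thesis
    using T by (simp add: C_carrier fun_eq_iff) (simp add: matrix_of_def)
qed

lemma operator_of_matrix_of: "T \<in> carrier B \<Longrightarrow> operator_of (matrix_of T) = T"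
proof (rule B_eqI)
  fix x assume T: "T \<in> carrier B" and x: "x \<in> carrier E"
  have "matrix_vector A (matrix_of T) x i = T x i" for i
  proof -
    have "T x i = (\<Oplus>k\<in>UNIV. ract E (T (column k)) (x k) i)"
      using T x by (subst B_expansion[OF T x]) (intro finsum_E, auto)
    then show ?thesis
      by (simp add: matrix_vector_def matrix_of_def)
  qed
  with x show "operator_of (matrix_of T) x = T x"
    by (simp add: operator_of_def fun_eq_iff)
qed (simp_all add: operator_of_closed matrix_of_closed)

text \<open>Applying L to the columns of P produces the matrix L P, which equals L in the
  corner.\<close>

lemma matrix_of_operator_of: "L \<in> carrier C \<Longrightarrow> matrix_of (operator_of L) = L"
  by (simp add: C_carrier matrix_of_def operator_of_def fun_eq_iff matrix_mult_entry)
    (simp add: column_def)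

text \<open>By \<open>E_eqI\<close> an adjoint is unique, so exhibiting one evaluates the definite
  description behind \<open>star B\<close>.\<close>

lemma B_starI:
  assumes "S \<in> carrier B" "\<And>x y. x \<in> carrier E \<Longrightarrow> y \<in> carrier E \<Longrightarrow> vector_ip x (T y) = vector_ip (S x) y"
  shows "star B T = S"
proof -
  have "(THE S. S \<in> carrier B \<and> (\<forall>x\<in>carrier E. \<forall>y\<in>carrier E. vector_ip x (T y) = vector_ip (S x) y)) = S"
  proof (rule the_equality)
    fix S' assume S': "S' \<in> carrier B \<and> (\<forall>x\<in>carrier E. \<forall>y\<in>carrier E. vector_ip x (T y) = vector_ip (S' x) y)"
    show "S' = S"
    proof (rule B_eqI)
      fix x assume x: "x \<in> carrier E"
      show "S' x = S x"
        by (rule E_eqI) (use S' assms x in auto)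
    qed (use S' assms in auto)
  qed (use assms in auto)
  then show ?thesis
    by (simp add: End_algebra_def)
qed

lemma C_star_closed:
  assumes "L \<in> carrier C"
  shows "star (matrix_algebra A) L \<in> carrier C"
proof -
  have closed: "\<And>i j. L i j \<in> carrier A" and PL: "P \<otimes>\<^bsub>matrix_algebra A\<^esub> L = L"
    and LP: "L \<otimes>\<^bsub>matrix_algebra A\<^esub> P = L"
    using assms by (simp_all add: C_carrier)
  have "P \<otimes>\<^bsub>matrix_algebra A\<^esub> star (matrix_algebra A) L = star (matrix_algebra A) L"
    "star (matrix_algebra A) L \<otimes>\<^bsub>matrix_algebra A\<^esub> P = star (matrix_algebra A) L"
    using matrix_mult_star[of L P, unfolded LP P_star] matrix_mult_star[of P L, unfolded PL P_star] closed
    by simp_all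
  moreover have "star (matrix_algebra A) L i j \<in> carrier A" for i j
    using closed by (simp add: matrix_algebra_def)
  ultimately show ?thesis
    by (simp add: C_carrier)
qed

text \<open>The adjoint on the free module restricts to \<open>E\<close>, because the corner is
  closed under the involution. This supplies the existence of adjoints.\<close>

lemma star_operator_of:
  assumes L: "L \<in> carrier C"
  shows "star B (operator_of L) = operator_of (star (matrix_algebra A) L)"
proof (rule B_starI)
  show "operator_of (star (matrix_algebra A) L) \<in> carrier B"
    by (intro operator_of_closed C_star_closed L)
  show "vector_ip x (operator_of L y) = vector_ip (operator_of (star (matrix_algebra A) L) x) y"
    if "x \<in> carrier E" "y \<in> carrier E" for x y
    using that L by (simp add: operator_of_def vector_ip_adjoint C_carrier)
qed

lemma star_iso_operator_of: "star_iso C B (\<lambda>L. \<lambda>x\<in>carrier E. matrix_vector A L x)"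
proof -
  have "operator_of \<in> ring_hom C B"
  proof (rule ring_hom_memI)
    fix K L assume KL: "K \<in> carrier C" "L \<in> carrier C"
    have L: "matrix_vector A L x \<in> carrier E" if "x \<in> carrier E" for x
      using operator_of_closed[OF KL(2)] that B_closed[of "operator_of L" x] by (simp add: operator_of_def)
    have closed: "\<And>i j. K i j \<in> carrier A" "\<And>i j. L i j \<in> carrier A"
      using KL by (simp_all add: C_carrier)
    show "operator_of (K \<otimes>\<^bsub>C\<^esub> L) = operator_of K \<otimes>\<^bsub>B\<^esub> operator_of L"
      by (intro ext) (simp add: operator_of_def compose_def restrict_def L closed
          matrix_vector_matrix_vector[symmetric])
    show "operator_of (K \<oplus>\<^bsub>C\<^esub> L) = operator_of K \<oplus>\<^bsub>B\<^esub> operator_of L"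
      by (intro ext) (simp add: operator_of_def restrict_def matrix_vector_def sum_add A_l_distr closed)
  next
    show "operator_of \<one>\<^bsub>C\<^esub> = \<one>\<^bsub>B\<^esub>"
      by (intro ext) (simp add: operator_of_def restrict_def E_carrier)
  qed (simp add: operator_of_closed)
  moreover have "bij_betw operator_of (carrier C) (carrier B)"
    by (rule bij_betw_byWitness[where f' = matrix_of])
      (auto simp: operator_of_matrix_of matrix_of_operator_of operator_of_closed matrix_of_closed)
  moreover have "operator_of (c \<odot>\<^bsub>C\<^esub> L) = c \<odot>\<^bsub>B\<^esub> operator_of L" if "L \<in> carrier C" for c L
  proof -
    have "\<And>i j. L i j \<in> carrier A"
      using that by (simp add: C_carrier)
    then show ?thesis
      by (intro ext) (simp add: operator_of_def restrict_def matrix_vector_def sum_smult smult_mult_left)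
  qed
  ultimately have "star_iso C B operator_of"
    by (simp add: star_iso_def ring_iso_def star_operator_of)
  then show ?thesis
    by (simp add: operator_of_def[abs_def])
qed

text \<open>Every endomorphism comes from a corner matrix, whose star gives the adjoint. Later
  arguments about adjoints rely on these two facts and on uniqueness, and no longer on
  matrices.\<close>

lemma
  assumes T: "T \<in> carrier B"
  shows B_star_closed: "star B T \<in> carrier B"
    and B_star_adjoint: "x \<in> carrier E \<Longrightarrow> y \<in> carrier E \<Longrightarrow> vector_ip x (T y) = vector_ip (star B T x) y"
proof -
  define L where "L = matrix_of T"
  have L: "L \<in> carrier C" and TL: "T = operator_of L"
    by (simp_all add: L_def T matrix_of_closed operator_of_matrix_of)
  show "star B T \<in> carrier B"
    using L by (simp add: TL star_operator_of operator_of_closed C_star_closed)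
  show "x \<in> carrier E \<Longrightarrow> y \<in> carrier E \<Longrightarrow> vector_ip x (T y) = vector_ip (star B T x) y"
    using L by (simp add: TL star_operator_of) (simp add: operator_of_def vector_ip_adjoint C_carrier)
qed

section \<open>The endomorphism algebra as a star algebra\<close>

lemma B_abelian_group: "abelian_group B"
proof (rule abelian_groupI)
  show "\<exists>S\<in>carrier B. S \<oplus>\<^bsub>B\<^esub> T = \<zero>\<^bsub>B\<^esub>" if T: "T \<in> carrier B" for T
  proof
    show "(- 1) \<odot>\<^bsub>B\<^esub> T \<in> carrier B" using T by (rule B_smult_closed)
    have "(- 1) \<odot> a \<oplus> a = \<zero>" if "a \<in> carrier A" for a
      using smult_add_left[OF that, of "-1" 1] that by simp
    with T show "(- 1) \<odot>\<^bsub>B\<^esub> T \<oplus>\<^bsub>B\<^esub> T = \<zero>\<^bsub>B\<^esub>"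
      by (intro B_eqI B_add_closed B_smult_closed B_zero_closed) simp_all
  qed
  show "\<zero>\<^bsub>B\<^esub> \<oplus>\<^bsub>B\<^esub> T = T" if "T \<in> carrier B" for T
    using that by (intro B_eqI B_add_closed B_zero_closed) (simp_all add: A_a_ac)
  show "R \<oplus>\<^bsub>B\<^esub> S \<oplus>\<^bsub>B\<^esub> T = R \<oplus>\<^bsub>B\<^esub> (S \<oplus>\<^bsub>B\<^esub> T)"
    if "R \<in> carrier B" "S \<in> carrier B" "T \<in> carrier B" for R S T
    using that by (intro B_eqI B_add_closed) (simp_all add: A_a_ac)
  show "S \<oplus>\<^bsub>B\<^esub> T = T \<oplus>\<^bsub>B\<^esub> S" if "S \<in> carrier B" "T \<in> carrier B" for S T
    using that by (intro B_eqI B_add_closed) (simp_all add: A_a_ac)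
qed (simp_all only: B_add_closed B_zero_closed)

lemma B_monoid: "monoid B"
proof (rule monoidI)
  show "R \<otimes>\<^bsub>B\<^esub> S \<otimes>\<^bsub>B\<^esub> T = R \<otimes>\<^bsub>B\<^esub> (S \<otimes>\<^bsub>B\<^esub> T)"
    if "R \<in> carrier B" "S \<in> carrier B" "T \<in> carrier B" for R S T
    using that by (intro B_eqI B_mult_closed) (simp_all add: compose_eq)
  show "\<one>\<^bsub>B\<^esub> \<otimes>\<^bsub>B\<^esub> T = T" if "T \<in> carrier B" for T
    using that by (intro B_eqI B_mult_closed B_one_closed) (simp_all add: compose_eq)
  show "T \<otimes>\<^bsub>B\<^esub> \<one>\<^bsub>B\<^esub> = T" if "T \<in> carrier B" for T
    using that by (intro B_eqI B_mult_closed B_one_closed) (simp_all add: compose_eq)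
qed (simp_all only: B_mult_closed B_one_closed)

lemma B_ring: "ring B"
proof (rule ringI[OF B_abelian_group B_monoid])
  show "(R \<oplus>\<^bsub>B\<^esub> S) \<otimes>\<^bsub>B\<^esub> T = R \<otimes>\<^bsub>B\<^esub> T \<oplus>\<^bsub>B\<^esub> S \<otimes>\<^bsub>B\<^esub> T"
    if "R \<in> carrier B" "S \<in> carrier B" "T \<in> carrier B" for R S T
    using that by (intro B_eqI B_mult_closed B_add_closed) (simp_all add: compose_eq)
  show "T \<otimes>\<^bsub>B\<^esub> (R \<oplus>\<^bsub>B\<^esub> S) = T \<otimes>\<^bsub>B\<^esub> R \<oplus>\<^bsub>B\<^esub> T \<otimes>\<^bsub>B\<^esub> S"
    if "R \<in> carrier B" "S \<in> carrier B" "T \<in> carrier B" for R S T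
    using that by (intro B_eqI B_mult_closed B_add_closed) (simp_all add: compose_eq B_add)
qed

lemma B_module: "module scalars B"
proof (rule moduleI[OF cring_scalars B_abelian_group], simp_all only: B_smult_closed scalars_simps)
  show "(a + b) \<odot>\<^bsub>B\<^esub> T = a \<odot>\<^bsub>B\<^esub> T \<oplus>\<^bsub>B\<^esub> b \<odot>\<^bsub>B\<^esub> T" if "T \<in> carrier B" for a b T
    using that by (intro B_eqI B_smult_closed B_add_closed) (simp_all add: smult_add_left)
  show "a \<odot>\<^bsub>B\<^esub> (S \<oplus>\<^bsub>B\<^esub> T) = a \<odot>\<^bsub>B\<^esub> S \<oplus>\<^bsub>B\<^esub> a \<odot>\<^bsub>B\<^esub> T" if "S \<in> carrier B" "T \<in> carrier B" for a S T
    using that by (intro B_eqI B_smult_closed B_add_closed) (simp_all add: smult_add_right)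
  show "(a * b) \<odot>\<^bsub>B\<^esub> T = a \<odot>\<^bsub>B\<^esub> (b \<odot>\<^bsub>B\<^esub> T)" if "T \<in> carrier B" for a b T
    using that by (intro B_eqI B_smult_closed) (simp_all add: smult_assoc)
  show "1 \<odot>\<^bsub>B\<^esub> T = T" if "T \<in> carrier B" for T
    using that by (intro B_eqI B_smult_closed) simp_all
qed

lemma B_star_star:
  assumes T: "T \<in> carrier B"
  shows "star B (star B T) = T"
proof (rule B_starI[OF T])
  fix x y assume xy: "x \<in> carrier E" "y \<in> carrier E"
  have "star A (vector_ip y (T x)) = star A (vector_ip (star B T y) x)"
    using T xy by (simp add: B_star_adjoint)
  then show "vector_ip x (star B T y) = vector_ip (T x) y"
    using xy T B_star_closed[OF T] by (simp add: vector_ip_star)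
qed

lemma B_star_algebra: "star_algebra B"
proof (intro star_algebra.intro B_ring B_module star_algebra_axioms.intro)
  fix S T c assume S: "S \<in> carrier B"
  note S' = B_star_closed[OF S]
  show "star B S \<in> carrier B" "star B (star B S) = S"
    using S by (simp_all only: B_star_closed B_star_star)
  show "star B (c \<odot>\<^bsub>B\<^esub> S) = cx_cnj c \<odot>\<^bsub>B\<^esub> star B S"
    by (rule B_starI[OF B_smult_closed[OF S']])
      (use S S' in \<open>simp add: vector_ip_smult vector_ip_smult_left B_star_adjoint\<close>)
  assume T: "T \<in> carrier B"
  note T' = B_star_closed[OF T]
  show "(c \<odot>\<^bsub>B\<^esub> S) \<otimes>\<^bsub>B\<^esub> T = c \<odot>\<^bsub>B\<^esub> (S \<otimes>\<^bsub>B\<^esub> T)"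
    using S T by (intro B_eqI B_mult_closed B_smult_closed) (simp_all add: compose_eq)
  show "S \<otimes>\<^bsub>B\<^esub> (c \<odot>\<^bsub>B\<^esub> T) = c \<odot>\<^bsub>B\<^esub> (S \<otimes>\<^bsub>B\<^esub> T)"
    using S T by (intro B_eqI B_mult_closed B_smult_closed) (simp_all add: compose_eq B_smult)
  show "star B (S \<oplus>\<^bsub>B\<^esub> T) = star B S \<oplus>\<^bsub>B\<^esub> star B T"
    by (rule B_starI[OF B_add_closed[OF S' T']])
      (use S T S' T' in \<open>simp add: vector_ip_add vector_ip_add_left B_star_adjoint\<close>)
  show "star B (S \<otimes>\<^bsub>B\<^esub> T) = star B T \<otimes>\<^bsub>B\<^esub> star B S"
    by (rule B_starI[OF B_mult_closed[OF T' S']])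
      (use S T S' T' in \<open>simp add: compose_eq B_star_adjoint\<close>)
qed

lemma finsum_B:
  assumes "finite I" "f \<in> I \<rightarrow> carrier B" "x \<in> carrier E"
  shows "finsum B f I x = (\<Oplus>\<^bsub>E\<^esub>j\<in>I. f j x)"
proof (rule abelian_group.additive_map_finsum[OF B_abelian_group E_abelian_group, where h = "\<lambda>T. T x" and f = f and I = I])
  show "T x \<in> carrier E" if "T \<in> carrier B" for T
    using that assms(3) by (rule B_closed)
  show "(S \<oplus>\<^bsub>B\<^esub> T) x = S x \<oplus>\<^bsub>E\<^esub> T x" for S T
    using assms(3) by simp
qed (use assms in simp_all)

section \<open>Rank-one operators\<close>

lemma lip_apply [simp]: "z \<in> carrier E \<Longrightarrow> lip E x y z = (\<lambda>i. x i \<otimes> vector_ip y z)"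
  by (simp add: lip_E)

lemma lip_closed [simp]:
  assumes "x \<in> carrier E" "y \<in> carrier E"
  shows "lip E x y \<in> carrier B"
  unfolding lip_E using assms
  by (subst B_carrier)
    (auto simp: vector_ip_add vector_ip_smult vector_ip_mult A_r_distr smult_mult_right A_assoc)

lemma lip_add:
  assumes "x \<in> carrier E" "y \<in> carrier E" "z \<in> carrier E"
  shows "lip E (\<lambda>i. x i \<oplus> y i) z = lip E x z \<oplus>\<^bsub>B\<^esub> lip E y z"
  using assms by (intro B_eqI B_add_closed lip_closed) (simp_all add: A_l_distr)

lemma lip_smult:
  assumes "x \<in> carrier E" "y \<in> carrier E"
  shows "lip E (\<lambda>i. c \<odot> x i) y = c \<odot>\<^bsub>B\<^esub> lip E x y"
  using assms by (intro B_eqI B_smult_closed lip_closed) (simp_all add: smult_mult_left)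

lemma lip_lact:
  assumes "x \<in> carrier E" "y \<in> carrier E" "T \<in> carrier B"
  shows "lip E (T x) y = T \<otimes>\<^bsub>B\<^esub> lip E x y"
  using assms by (intro B_eqI B_mult_closed lip_closed) (simp_all add: compose_eq B_ract)

text \<open>For the adjoint relation at u and v, both sides equal the product <u, x> <y, v>.\<close>

lemma lip_star:
  assumes x: "x \<in> carrier E" and y: "y \<in> carrier E"
  shows "star B (lip E x y) = lip E y x"
proof (rule B_starI[OF lip_closed[OF y x]])
  fix u v assume uv: "u \<in> carrier E" "v \<in> carrier E"
  then show "vector_ip u (lip E x y v) = vector_ip (lip E y x u) v"
    using x y by (simp add: vector_ip_mult vector_ip_mult_left vector_ip_star)
qed

text \<open>The rank-one operators of the columns sum to the identity, since \<open>x j\<close> is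
  the inner product of \<open>column j\<close> with x; T is composed with this sum. Fullness of
  \<open>lip\<close> follows.\<close>

lemma B_rank_one_expansion:
  assumes T: "T \<in> carrier B"
  shows "T = (\<Oplus>\<^bsub>B\<^esub>j\<in>UNIV. lip E (T (column j)) (column j))"
proof (rule B_eqI[OF T])
  have *: "(\<lambda>j. lip E (T (column j)) (column j)) \<in> UNIV \<rightarrow> carrier B"
    using T lip_closed by auto
  then show "(\<Oplus>\<^bsub>B\<^esub>j\<in>UNIV. lip E (T (column j)) (column j)) \<in> carrier B"
    by (rule abelian_monoid.finsum_closed[OF abelian_group.axioms(1)[OF B_abelian_group]])
  fix x assume x: "x \<in> carrier E"
  then show "T x = (\<Oplus>\<^bsub>B\<^esub>j\<in>UNIV. lip E (T (column j)) (column j)) x"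
    using * by (subst finsum_B) (simp_all add: B_expansion[OF T x] column_ip)
qed

end

section \<open>Strongly full projections\<close>

locale strongly_full_module = projection_module A P
  for A :: "('r::linordered_idom cx, 'a, 'm) star_alg_scheme" (structure)
    and P :: "'n::finite \<Rightarrow> 'n \<Rightarrow> 'a" +
  fixes \<tau> :: 'a
  assumes \<tau>_unit: "\<tau> \<in> Units A"
    and trace: "matrix_trace A P = inv (\<tau> \<otimes> star A \<tau>)"
begin

text \<open>The vectors y_j of the overview. The squares of the columns sum to the trace of P, and
  the factor \<tau> normalizes that sum.\<close>

definition frame :: "'n \<Rightarrow> 'n \<Rightarrow> 'a" where
  "frame j = ract E (column j) \<tau>"

lemma \<tau>_closed [simp]: "\<tau> \<in> carrier A"
  using \<tau>_unit by (rule monoid.Units_closed[OF monoid_carrier])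

lemma frame_closed [simp]: "frame j \<in> carrier E"
  by (simp add: frame_def)

lemma frame_ip: "x \<in> carrier E \<Longrightarrow> vector_ip (frame j) x = star A \<tau> \<otimes> x j"
  by (simp add: frame_def vector_ip_mult_left column_ip)

lemma frame_sum: "(\<Oplus>j\<in>UNIV. vector_ip (frame j) (frame j)) = \<one>"
proof -
  have \<tau>': "star A \<tau> \<in> Units A"
    using \<tau>_unit by (rule star_Units)
  have "(\<Oplus>j\<in>UNIV. vector_ip (frame j) (frame j)) = star A \<tau> \<otimes> (matrix_trace A P \<otimes> \<tau>)"
    by (simp add: frame_ip) (simp add: frame_def column_def matrix_trace_def sum_mult_left sum_mult_right)
  \<comment> \<open>Inversion reverses the product of \<tau> and \<open>star A \<tau>\<close>, so
    the inverse of \<tau> stands on the right and cancels.\<close>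
  also have "matrix_trace A P \<otimes> \<tau> = inv (star A \<tau>)"
    using \<tau>_unit \<tau>' by (simp add: trace A_assoc monoid.inv_mult_Units[OF monoid_carrier])
  finally show ?thesis
    using \<tau>' by simp
qed

text \<open>The j-th summand sends z to x <y_j, y_j> <y, z>. Summing over j inserts the unit between
  x and <y, z>.\<close>

lemma lip_frame:
  assumes x: "x \<in> carrier E" and y: "y \<in> carrier E"
  shows "lip E x y = (\<Oplus>\<^bsub>B\<^esub>j\<in>UNIV. star B (lip E (frame j) x) \<otimes>\<^bsub>B\<^esub> lip E (frame j) y)"
proof (rule B_eqI[OF lip_closed[OF x y]])
  have *: "star B (lip E (frame j) x) \<otimes>\<^bsub>B\<^esub> lip E (frame j) y \<in> carrier B" for j
    using x y by (intro B_mult_closed B_star_closed lip_closed frame_closed)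
  then show "(\<Oplus>\<^bsub>B\<^esub>j\<in>UNIV. star B (lip E (frame j) x) \<otimes>\<^bsub>B\<^esub> lip E (frame j) y) \<in> carrier B"
    by (intro abelian_monoid.finsum_closed[OF abelian_group.axioms(1)[OF B_abelian_group]]) simp
  fix z assume z: "z \<in> carrier E"
  have summand: "(star B (lip E (frame j) x) \<otimes>\<^bsub>B\<^esub> lip E (frame j) y) z
      = (\<lambda>i. x i \<otimes> (vector_ip (frame j) (frame j) \<otimes> vector_ip y z))" for j
    using x y z by (simp only: lip_star frame_closed) (simp add: compose_eq vector_ip_mult)
  have "(\<Oplus>\<^bsub>B\<^esub>j\<in>UNIV. star B (lip E (frame j) x) \<otimes>\<^bsub>B\<^esub> lip E (frame j) y) z i = lip E x y z i" for i
  proof -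
    have "(\<Oplus>\<^bsub>B\<^esub>j\<in>UNIV. star B (lip E (frame j) x) \<otimes>\<^bsub>B\<^esub> lip E (frame j) y) z i
        = (\<Oplus>j\<in>UNIV. x i \<otimes> (vector_ip (frame j) (frame j) \<otimes> vector_ip y z))"
      using * x y z by (subst finsum_B, simp_all only: summand)
        (auto intro!: finsum_E)
    also have "\<dots> = x i \<otimes> ((\<Oplus>j\<in>UNIV. vector_ip (frame j) (frame j)) \<otimes> vector_ip y z)"
      using x y z by (simp add: sum_mult_left sum_mult_right)
    finally show ?thesis
      using x y z by (simp add: frame_sum)
  qed
  then show "lip E x y z = (\<Oplus>\<^bsub>B\<^esub>j\<in>UNIV. star B (lip E (frame j) x) \<otimes>\<^bsub>B\<^esub> lip E (frame j) y) z"
    by (intro ext) (rule sym)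
qed

text \<open>Multiplying the frame identity by a on the right gives a as the sum of <y_j, y_j
  a>.\<close>

lemma rip_full: "module_span A {vector_ip x y | x y. x \<in> carrier E \<and> y \<in> carrier E} = carrier A"
proof (rule module_span_eq_carrier)
  show "\<exists>f \<in> (UNIV :: 'n set) \<rightarrow> {vector_ip x y | x y. x \<in> carrier E \<and> y \<in> carrier E}. a = (\<Oplus>i\<in>UNIV. f i)"
    if a: "a \<in> carrier A" for a
  proof
    have "(\<Oplus>j\<in>UNIV. vector_ip (frame j) (\<lambda>i. frame j i \<otimes> a)) = (\<Oplus>j\<in>UNIV. vector_ip (frame j) (frame j)) \<otimes> a"
      using a by (simp add: vector_ip_mult sum_mult_left)
    with a show "a = (\<Oplus>j\<in>UNIV. vector_ip (frame j) (\<lambda>i. frame j i \<otimes> a))"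
      by (simp add: frame_sum)
    show "(\<lambda>j. vector_ip (frame j) (\<lambda>i. frame j i \<otimes> a))
        \<in> UNIV \<rightarrow> {vector_ip x y | x y. x \<in> carrier E \<and> y \<in> carrier E}"
      by (rule Pi_I, rule CollectI, intro exI conjI, rule refl) (use a in simp_all)
  qed
qed auto

lemma lip_full: "module_span B {lip E x y | x y. x \<in> carrier E \<and> y \<in> carrier E} = carrier B"
proof (rule star_algebra.module_span_eq_carrier[OF B_star_algebra])
  show "{lip E x y | x y. x \<in> carrier E \<and> y \<in> carrier E} \<subseteq> carrier B"
    using lip_closed by blast
  show "\<exists>f \<in> (UNIV :: 'n set) \<rightarrow> {lip E x y | x y. x \<in> carrier E \<and> y \<in> carrier E}. T = (\<Oplus>\<^bsub>B\<^esub>i\<in>UNIV. f i)"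
    if T: "T \<in> carrier B" for T
  proof
    show "T = (\<Oplus>\<^bsub>B\<^esub>j\<in>UNIV. lip E (T (column j)) (column j))"
      using T by (rule B_rank_one_expansion)
    show "(\<lambda>j. lip E (T (column j)) (column j)) \<in> UNIV \<rightarrow> {lip E x y | x y. x \<in> carrier E \<and> y \<in> carrier E}"
      by (rule Pi_I, rule CollectI, intro exI conjI, rule refl) (use T in simp_all)
  qed
qed simp

lemma E_condition_P: "condition_P A E TYPE('h)"
  by (rule condition_P_coordinates[where I = UNIV and g = "\<lambda>i x. x i"])
    (auto simp: vector_ip_def)

text \<open>The coordinates \<open>lip E (frame j) x\<close> are antilinear in x, hence linear for
  the conjugate scalars. They are right linear over the endomorphisms, because T acts on the
  conjugate module through its adjoint: y_j <star(T) x, z> = y_j <x, T z>.\<close>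

lemma E_condition_Q: "condition_P B (conjugate_module B E) TYPE('h)"
proof (rule star_algebra.condition_P_coordinates[OF B_star_algebra, where I = UNIV and g = "\<lambda>j x. lip E (frame j) x"])
  have [simp]: "carrier (conjugate_module B E) = carrier E" "add (conjugate_module B E) = add E"
    "module.smult (conjugate_module B E) = (\<lambda>c x i. cx_cnj c \<odot> x i)"
    "ract (conjugate_module B E) = (\<lambda>x T. star B T x)"
    "rip (conjugate_module B E) = lip E"
    by (simp_all only: conjugate_module_def inner_module.select_convs module.select_convs
        ring.select_convs monoid.select_convs partial_object.select_convs E_simps)
  fix x y c T and j :: 'n
  assume x: "x \<in> carrier (conjugate_module B E)"
  show "c \<odot>\<^bsub>conjugate_module B E\<^esub> x \<in> carrier (conjugate_module B E)"
    using x by simp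
  show fx: "lip E (frame j) x \<in> carrier B"
    using x by (simp only: lip_closed frame_closed \<open>carrier (conjugate_module B E) = carrier E\<close>)
  show "lip E (frame j) (c \<odot>\<^bsub>conjugate_module B E\<^esub> x) = c \<odot>\<^bsub>B\<^esub> lip E (frame j) x"
    using x
    by (intro B_eqI B_smult_closed fx lip_closed) (simp_all add: vector_ip_smult_left smult_mult_right)
  show "T \<in> carrier B \<Longrightarrow> ract (conjugate_module B E) x T \<in> carrier (conjugate_module B E)"
    using x by (simp add: B_star_closed)
  show "lip E (frame j) (ract (conjugate_module B E) x T) = lip E (frame j) x \<otimes>\<^bsub>B\<^esub> T"
    if T: "T \<in> carrier B"
    using x T B_star_closed[OF T]
    by (intro B_eqI B_mult_closed fx lip_closed) (simp_all add: compose_eq B_star_adjoint)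
  assume y: "y \<in> carrier (conjugate_module B E)"
  show "x \<oplus>\<^bsub>conjugate_module B E\<^esub> y \<in> carrier (conjugate_module B E)"
    using x y by simp
  show "lip E (frame j) (x \<oplus>\<^bsub>conjugate_module B E\<^esub> y) = lip E (frame j) x \<oplus>\<^bsub>B\<^esub> lip E (frame j) y"
    using x y
    by (intro B_eqI B_add_closed lip_closed) (simp_all add: vector_ip_add_left A_r_distr)
  have "x \<in> carrier E" "y \<in> carrier E"
    using x y by simp_all
  then show "rip (conjugate_module B E) x y = (\<Oplus>\<^bsub>B\<^esub>i\<in>UNIV. star B (lip E (frame i) x) \<otimes>\<^bsub>B\<^esub> lip E (frame i) y)"
    unfolding \<open>rip (conjugate_module B E) = lip E\<close> by (rule lip_frame)
qed simp

lemma E_bimodule: "bimodule B A E"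
  by (intro bimodule.intro B_star_algebra star_algebra_axioms E_module bimodule_axioms.intro)
    (auto simp: B_add B_smult B_ract compose_eq A_l_distr A_r_distr smult_mult_left smult_mult_right A_assoc)

theorem E_equivalence_bimodule: "equivalence_bimodule B A E TYPE('h)"
proof (intro equivalence_bimodule.intro E_bimodule equivalence_bimodule_axioms.intro)
  fix x assume x: "x \<in> carrier E"
  show "rip E x x \<in> positive_elements A"
    using x sum_of_squares_positive[of UNIV x] by (simp add: vector_ip_def)
  have "(\<lambda>j. lip E (frame j) x) \<in> UNIV \<rightarrow> carrier B"
    using x lip_closed frame_closed by auto
  then show "lip E x x \<in> positive_elements B"
    unfolding lip_frame[OF x x] by (intro star_algebra.sum_of_squares_positive[OF B_star_algebra]) auto
next
  fix x y z assume "x \<in> carrier E" "y \<in> carrier E" "z \<in> carrier E"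
  then show "lip E (x \<oplus>\<^bsub>E\<^esub> y) z = lip E x z \<oplus>\<^bsub>B\<^esub> lip E y z"
    using lip_add by (simp only: E_simps(1))
next
  fix x y c assume "x \<in> carrier E" "y \<in> carrier E"
  then show "lip E (c \<odot>\<^bsub>E\<^esub> x) y = c \<odot>\<^bsub>B\<^esub> lip E x y"
    using lip_smult by (simp only: E_simps(3))
next
  fix x y T assume "x \<in> carrier E" "y \<in> carrier E" "T \<in> carrier B"
  then show "lip E (lact E T x) y = T \<otimes>\<^bsub>B\<^esub> lip E x y"
    using lip_lact by (simp only: E_simps(6))
next
  fix x y a assume xy: "x \<in> carrier E" "y \<in> carrier E" and a: "a \<in> carrier A"
  then show "lip E x (ract E y a) = lip E (ract E x (star A a)) y"
    by (intro B_eqI lip_closed) (simp_all add: vector_ip_mult_left A_assoc)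
next
  show "module_span A {rip E x y | x y. x \<in> carrier E \<and> y \<in> carrier E} = carrier A"
    using rip_full by simp
qed (simp_all add: vector_ip_add vector_ip_smult vector_ip_mult vector_ip_star B_star_adjoint
    E_condition_P E_condition_Q lip_full lip_star lip_closed)

lemma E_nondegenerate: "nondegenerate B A E"
  by (simp add: nondegenerate_def)

end

section \<open>Formal deformations\<close>

text \<open>The Banach fixed point theorem for the \<open>\<lambda>\<close>-adic metric.\<close>

lemma coefficientwise_fixed_point:
  fixes F :: "(nat \<Rightarrow> 'a) \<Rightarrow> nat \<Rightarrow> 'a"
  assumes "f0 \<in> Pi UNIV S" and F: "\<And>f. f \<in> Pi UNIV S \<Longrightarrow> F f \<in> Pi UNIV S"
    and contraction: "\<And>f g N. f \<in> Pi UNIV S \<Longrightarrow> g \<in> Pi UNIV S \<Longrightarrow> \<forall>i<N. f i = g i \<Longrightarrow> F f N = F g N"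
  obtains f where "f \<in> Pi UNIV S" "F f = f"
proof -
  define u where "u n = (F ^^ n) f0" for n
  have u: "u n \<in> Pi UNIV S" for n
    by (induction n) (use assms(1) F in \<open>simp_all add: u_def\<close>)
  \<comment> \<open>Each application of F extends the agreement of consecutive iterates by one
    coefficient.\<close>
  have step: "u (Suc n) i = u n i" if "i < n" for n i
    using that
  proof (induction n arbitrary: i)
    case (Suc n)
    then have "F (u (Suc n)) i = F (u n) i"
      by (intro contraction u) simp
    then show ?case
      by (simp add: u_def)
  qed simp
  have stable: "u n i = u (Suc i) i" if "i < n" for n i
    using that
  proof (induction n)
    case (Suc n)
    then show ?case
      using step[of i n] by (cases "i = n") auto
  qed simp
  \<comment> \<open>Coefficient i is settled from iterate i + 1 on, so the limit is read off along
    this diagonal.\<close>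
  define f where "f i = u (Suc i) i" for i
  show thesis
  proof
    show f: "f \<in> Pi UNIV S"
      using u unfolding f_def Pi_def by blast
    show "F f = f"
    proof
      fix N
      have "F f N = F (u N) N"
        by (intro contraction f u) (simp add: f_def stable[of _ N])
      then show "F f N = f N"
        by (simp add: f_def u_def)
    qed
  qed
qed

lemma cx_fps_nth_simps [simp]:
  "cx_fps_nth (z + w) k = cx_fps_nth z k + cx_fps_nth w k"
  "cx_fps_nth (cx_cnj z) k = cx_cnj (cx_fps_nth z k)"
  by (simp_all add: cx_fps_nth_def plus_cx_def cx_cnj_def)

lemma cx_re_im_sum: "cx_re (\<Sum>i\<in>I. f i) = (\<Sum>i\<in>I. cx_re (f i))" "cx_im (\<Sum>i\<in>I. f i) = (\<Sum>i\<in>I. cx_im (f i))"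
  by (induction I rule: infinite_finite_induct) (auto simp: zero_cx_def plus_cx_def)

lemma cx_fps_nth_mult: "cx_fps_nth (z * w) k = (\<Sum>i\<in>{..k}. cx_fps_nth z i * cx_fps_nth w (k - i))"
  by (rule cx.expand)
    (simp add: cx_fps_nth_def times_cx_def fps_mult_nth cx_re_im_sum sum_subtractf sum.distrib atLeast0AtMost)

text \<open>The scalar lambda^N in R[[lambda]](i); acting with it shifts coefficients by N.\<close>

definition cx_monomial :: "nat \<Rightarrow> 'r::linordered_idom fps cx" where
  "cx_monomial N = Cx (fps_X ^ N) 0"

lemma cx_fps_nth_monomial: "cx_fps_nth (cx_monomial N) k = (if N = k then 1 else 0)"
  by (simp add: cx_fps_nth_def cx_monomial_def fps_X_power_nth zero_cx_def one_cx_def)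

lemma cx_monomial_0: "cx_monomial 0 = 1"
  by (simp add: cx_monomial_def one_cx_def)

lemma (in star_algebra) scalar_sum_smult:
  "finite I \<Longrightarrow> x \<in> carrier A \<Longrightarrow> (\<Sum>i\<in>I. c i) \<odot> x = (\<Oplus>i\<in>I. c i \<odot> x)"
proof (induction I rule: finite_induct)
  case (insert i I)
  then show ?case
    by (subst abelian_monoid.finsum_insert[OF abelian_monoid_carrier]) (auto simp: smult_add_left)
qed simp

lemma (in star_algebra) star_inv: "a \<in> Units A \<Longrightarrow> star A (inv a) = inv (star A a)"
proof -
  assume a: "a \<in> Units A"
  have "a \<in> carrier A" "inv a \<in> carrier A"
    using a monoid.Units_closed[OF monoid_carrier] by simp_all
  then show ?thesis
    using a by (intro monoid.inv_char[OF monoid_carrier, symmetric]) (simp_all add: star_mult[symmetric])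
qed

text \<open>Put v = s inv(T). As s is Hermitian, the root equation says t = star(v) v, and the
  inverse of v, which is T inv(s), is the required \<tau>.\<close>

lemma (in star_algebra) inverse_square_of_root:
  assumes T: "T \<in> Units A" and s: "s \<in> Units A" "star A s = s" and t: "t \<in> carrier A"
    and root: "s \<otimes> s = star A T \<otimes> t \<otimes> T"
  shows "\<exists>\<tau>\<in>Units A. t = inv (\<tau> \<otimes> star A \<tau>)"
proof
  note Units_closed = monoid.Units_closed[OF monoid_carrier]
  have T': "star A T \<in> Units A"
    using T by (rule star_Units)
  show \<tau>: "T \<otimes> inv s \<in> Units A"
    using T s by simp
  have [simp]: "T \<in> carrier A" "s \<in> carrier A" "inv T \<in> carrier A" "inv (star A T) \<in> carrier A"
    using T T' s Units_closed by simp_all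
  have inv_\<tau>: "inv (T \<otimes> inv s) = s \<otimes> inv T"
    using T s by (simp add: monoid.inv_mult_Units[OF monoid_carrier])
  have "inv ((T \<otimes> inv s) \<otimes> star A (T \<otimes> inv s)) = inv (star A (T \<otimes> inv s)) \<otimes> inv (T \<otimes> inv s)"
    using \<tau> star_Units[OF \<tau>] by (rule monoid.inv_mult_Units[OF monoid_carrier])
  also have "inv (star A (T \<otimes> inv s)) = star A (s \<otimes> inv T)"
    using star_inv[OF \<tau>] by (simp add: inv_\<tau>)
  also have "\<dots> = inv (star A T) \<otimes> s"
    using T s by (simp add: star_mult star_inv)
  also have "inv (star A T) \<otimes> s \<otimes> inv (T \<otimes> inv s) = inv (star A T) \<otimes> (s \<otimes> s) \<otimes> inv T"
    by (simp add: inv_\<tau> A_assoc)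
  also have "\<dots> = (inv (star A T) \<otimes> star A T) \<otimes> t \<otimes> (T \<otimes> inv T)"
    using t by (simp add: root A_assoc del: monoid.Units_r_inv monoid.Units_l_inv)
  also have "\<dots> = t"
    using T T' t by simp
  finally show "t = inv ((T \<otimes> inv s) \<otimes> star A (T \<otimes> inv s))"
    by simp
qed

section \<open>The deformed algebra as a star algebra over R[[lambda]](i)\<close>

context hermitian_deformation
begin

abbreviation "D \<equiv> deformed_algebra A m"

lemma D_carrier: "f \<in> carrier D \<longleftrightarrow> (\<forall>r. f r \<in> carrier A)"
  by (simp add: deformed_algebra_def)

lemma D_entry [simp]: "f \<in> carrier D \<Longrightarrow> f r \<in> carrier A"
  by (simp add: D_carrier)

lemma D_simps [simp]:
  "monoid.mult D = (\<star>)" "one D = const_series A \<one>" "zero D = (\<lambda>r. \<zero>)"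
  "add D = (\<lambda>f g r. f r \<oplus> g r)" "star D = (\<lambda>f r. star A (f r))"
  by (simp_all only: deformed_algebra_def star_alg.select_convs ring.select_convs monoid.select_convs)

lemma D_smult: "z \<odot>\<^bsub>D\<^esub> f = (\<lambda>r. \<Oplus>k\<in>{..r}. cx_fps_nth z k \<odot> f (r - k))"
  by (simp only: deformed_algebra_def module.select_convs)

lemma const_series_closed [simp]: "a \<in> carrier A \<Longrightarrow> const_series A a \<in> carrier D"
  by (simp add: D_carrier const_series_def)

lemma D_mult_closed [simp]: "f \<in> carrier D \<Longrightarrow> g \<in> carrier D \<Longrightarrow> f \<star> g \<in> carrier D"
  using bilinear by (simp add: bilinear_map_def)

lemma D_l_distr: "f \<in> carrier D \<Longrightarrow> g \<in> carrier D \<Longrightarrow> h \<in> carrier D \<Longrightarrow>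
    (\<lambda>r. f r \<oplus> g r) \<star> h = (\<lambda>r. (f \<star> h) r \<oplus> (g \<star> h) r)"
  and D_r_distr: "f \<in> carrier D \<Longrightarrow> g \<in> carrier D \<Longrightarrow> h \<in> carrier D \<Longrightarrow>
    f \<star> (\<lambda>r. g r \<oplus> h r) = (\<lambda>r. (f \<star> g) r \<oplus> (f \<star> h) r)"
  using bilinear by (simp_all add: bilinear_map_def)

lemma D_smult_left: "f \<in> carrier D \<Longrightarrow> g \<in> carrier D \<Longrightarrow> (z \<odot>\<^bsub>D\<^esub> f) \<star> g = z \<odot>\<^bsub>D\<^esub> (f \<star> g)"
  and D_smult_right: "f \<in> carrier D \<Longrightarrow> g \<in> carrier D \<Longrightarrow> f \<star> (z \<odot>\<^bsub>D\<^esub> g) = z \<odot>\<^bsub>D\<^esub> (f \<star> g)"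
  using bilinear by (simp_all add: bilinear_map_def)

lemma finsum_A_closed: "(\<And>i. i \<in> I \<Longrightarrow> f i \<in> carrier A) \<Longrightarrow> finsum A f I \<in> carrier A"
  by (intro abelian_monoid.finsum_closed[OF abelian_monoid_carrier]) simp

lemma D_smult_closed: "f \<in> carrier D \<Longrightarrow> z \<odot>\<^bsub>D\<^esub> f \<in> carrier D"
  by (simp add: D_smult D_carrier finsum_A_closed)

lemma D_smult_monomial:
  "f \<in> carrier D \<Longrightarrow> (cx_monomial N \<odot>\<^bsub>D\<^esub> f) r = (if N \<le> r then f (r - N) else \<zero>)"
proof -
  assume f: "f \<in> carrier D"
  have "(cx_monomial N \<odot>\<^bsub>D\<^esub> f) r = (\<Oplus>k\<in>{..r}. if N = k then f (r - k) else \<zero>)"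
    unfolding D_smult using f
    by (intro abelian_monoid.finsum_cong'[OF abelian_monoid_carrier]) (auto simp: cx_fps_nth_monomial)
  also have "\<dots> = (if N \<le> r then f (r - N) else \<zero>)"
  proof (cases "N \<le> r")
    case True
    with f show ?thesis
      by (simp add: abelian_monoid.finsum_singleton[OF abelian_monoid_carrier])
  next
    case False
    then have "(\<Oplus>k\<in>{..r}. if N = k then f (r - k) else \<zero>) = (\<Oplus>k\<in>{..r}. \<zero>)"
      by (intro abelian_monoid.finsum_cong'[OF abelian_monoid_carrier]) auto
    with False show ?thesis
      by (simp add: abelian_monoid.finsum_zero[OF abelian_monoid_carrier])
  qed
  finally show ?thesis .
qed

lemma D_abelian_group: "abelian_group D"
proof (rule abelian_groupI)
  show "\<exists>g\<in>carrier D. g \<oplus>\<^bsub>D\<^esub> f = \<zero>\<^bsub>D\<^esub>" if "f \<in> carrier D" for f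
    by (rule bexI[of _ "\<lambda>r. \<ominus> f r"])
      (use that in \<open>auto simp: D_carrier abelian_group.l_neg[OF abelian_group_carrier]\<close>)
qed (auto simp: D_carrier A_a_ac)

lemma D_monoid: "monoid D"
  by (rule monoidI) (auto simp: assoc unit)

lemma D_ring: "ring D"
  by (rule ringI[OF D_abelian_group D_monoid]) (auto simp: D_l_distr D_r_distr)

lemma D_module: "module scalars D"
proof (rule moduleI[OF cring_scalars D_abelian_group])
  fix z w f assume f: "f \<in> carrier D"
  show "z \<odot>\<^bsub>D\<^esub> f \<in> carrier D"
    using f by (rule D_smult_closed)
  show "\<one>\<^bsub>scalars\<^esub> \<odot>\<^bsub>D\<^esub> f = f"
    using D_smult_monomial[OF f, of 0] by (simp add: fun_eq_iff cx_monomial_0)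
  show "(z \<oplus>\<^bsub>scalars\<^esub> w) \<odot>\<^bsub>D\<^esub> f = z \<odot>\<^bsub>D\<^esub> f \<oplus>\<^bsub>D\<^esub> w \<odot>\<^bsub>D\<^esub> f"
    using f by (auto simp: D_smult smult_add_left fun_eq_iff
        intro!: abelian_monoid.finsum_addf[OF abelian_monoid_carrier])
  show "z \<odot>\<^bsub>D\<^esub> (f \<oplus>\<^bsub>D\<^esub> g) = z \<odot>\<^bsub>D\<^esub> f \<oplus>\<^bsub>D\<^esub> z \<odot>\<^bsub>D\<^esub> g" if g: "g \<in> carrier D" for g
    using f g by (auto simp: D_smult smult_add_right fun_eq_iff
        intro!: abelian_monoid.finsum_addf[OF abelian_monoid_carrier])
  show "(z \<otimes>\<^bsub>scalars\<^esub> w) \<odot>\<^bsub>D\<^esub> f = z \<odot>\<^bsub>D\<^esub> (w \<odot>\<^bsub>D\<^esub> f)"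
  proof
    fix r
    \<comment> \<open>Coefficient r of either side is the sum of \<open>F i j\<close> over i + j
      \<le> r, so \<open>finsum_triangle\<close> connects the two.\<close>
    define F where "F i j = cx_fps_nth z i \<odot> (cx_fps_nth w j \<odot> f (r - i - j))" for i j
    have F: "F i j \<in> carrier A" for i j
      using f by (simp add: F_def)
    have "((z \<otimes>\<^bsub>scalars\<^esub> w) \<odot>\<^bsub>D\<^esub> f) r = (\<Oplus>k\<in>{..r}. \<Oplus>i\<in>{..k}. F i (k - i))"
      unfolding D_smult
    proof (rule abelian_monoid.finsum_cong'[OF abelian_monoid_carrier])
      fix k assume "k \<in> {..r}"
      have "(\<Oplus>i\<in>{..k}. F i (k - i)) = (\<Oplus>i\<in>{..k}. (cx_fps_nth z i * cx_fps_nth w (k - i)) \<odot> f (r - k))"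
        using f by (intro abelian_monoid.finsum_cong'[OF abelian_monoid_carrier]) (auto simp: F_def smult_assoc)
      also have "\<dots> = cx_fps_nth (z * w) k \<odot> f (r - k)"
        using f by (simp add: cx_fps_nth_mult scalar_sum_smult)
      finally show "cx_fps_nth (z \<otimes>\<^bsub>scalars\<^esub> w) k \<odot> f (r - k) = (\<Oplus>i\<in>{..k}. F i (k - i))"
        by simp
    qed (auto intro!: finsum_A_closed F)
    also have "\<dots> = (\<Oplus>i\<in>{..r}. \<Oplus>j\<in>{..r-i}. F i j)"
      using F by (rule abelian_monoid.finsum_triangle[OF abelian_monoid_carrier])
    also have "\<dots> = (z \<odot>\<^bsub>D\<^esub> (w \<odot>\<^bsub>D\<^esub> f)) r"
      unfolding D_smult
    proof (rule abelian_monoid.finsum_cong'[OF abelian_monoid_carrier])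
      fix i assume "i \<in> {..r}"
      show "(\<Oplus>j\<in>{..r-i}. F i j) = cx_fps_nth z i \<odot> (\<Oplus>k\<in>{..r-i}. cx_fps_nth w k \<odot> f (r - i - k))"
        unfolding F_def using f by (intro finsum_smult_ldistr[symmetric]) auto
    qed (use f in \<open>auto intro!: finsum_A_closed\<close>)
    finally show "((z \<otimes>\<^bsub>scalars\<^esub> w) \<odot>\<^bsub>D\<^esub> f) r = (z \<odot>\<^bsub>D\<^esub> (w \<odot>\<^bsub>D\<^esub> f)) r" .
  qed
qed

lemma D_star_algebra: "star_algebra D"
proof (intro star_algebra.intro D_ring D_module star_algebra_axioms.intro)
  fix f z assume f: "f \<in> carrier D"
  show "star D (z \<odot>\<^bsub>D\<^esub> f) = cx_cnj z \<odot>\<^bsub>D\<^esub> star D f"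
    using f by (auto simp: D_smult fun_eq_iff star_finsum star_smult)
  fix g assume g: "g \<in> carrier D"
  show "star D (f \<otimes>\<^bsub>D\<^esub> g) = star D g \<otimes>\<^bsub>D\<^esub> star D f"
    using hermitian[OF f g] by simp
qed (simp_all add: D_carrier D_smult_left D_smult_right star_add)

sublocale D: star_algebra D
  by (rule D_star_algebra)

text \<open>The \<open>\<lambda>\<close>-adic continuity of the product is a consequence of its \<open>C[[\<lambda>]]\<close>-bilinearity.\<close>

lemma divide_by_monomial:
  assumes "f \<in> carrier D" "\<forall>i<N. f i = \<zero>"
  shows "f = cx_monomial N \<odot>\<^bsub>D\<^esub> (\<lambda>r. f (r + N))" "(\<lambda>r. f (r + N)) \<in> carrier D"
proof -
  show *: "(\<lambda>r. f (r + N)) \<in> carrier D"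
    using assms by (simp add: D_carrier)
  show "f = cx_monomial N \<odot>\<^bsub>D\<^esub> (\<lambda>r. f (r + N))"
    using assms by (auto simp: D_smult_monomial[OF *] fun_eq_iff not_le)
qed

text \<open>The factor f is lambda^N times its shift, and bilinearity over power series pulls the
  scalar out of the product.\<close>

lemma mult_left_shift:
  assumes "f \<in> carrier D" "g \<in> carrier D" "\<forall>i<N. f i = \<zero>"
  shows "(f \<star> g) r = (if N \<le> r then ((\<lambda>r. f (r + N)) \<star> g) (r - N) else \<zero>)"
proof -
  have "f \<star> g = cx_monomial N \<odot>\<^bsub>D\<^esub> ((\<lambda>r. f (r + N)) \<star> g)"
    using assms by (subst divide_by_monomial(1)[OF assms(1,3)]) (intro D_smult_left divide_by_monomial(2))
  then show ?thesis
    using assms by (simp add: D_smult_monomial divide_by_monomial(2))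
qed

lemma mult_right_shift:
  assumes "f \<in> carrier D" "g \<in> carrier D" "\<forall>i<N. g i = \<zero>"
  shows "(f \<star> g) r = (if N \<le> r then (f \<star> (\<lambda>r. g (r + N))) (r - N) else \<zero>)"
proof -
  have "f \<star> g = cx_monomial N \<odot>\<^bsub>D\<^esub> (f \<star> (\<lambda>r. g (r + N)))"
    using assms by (subst divide_by_monomial(1)[OF assms(2,3)]) (intro D_smult_right divide_by_monomial(2))
  then show ?thesis
    using assms by (simp add: D_smult_monomial divide_by_monomial(2))
qed

lemma const_series_mult_0: "a \<in> carrier A \<Longrightarrow> b \<in> carrier A \<Longrightarrow>
    (const_series A a \<star> const_series A b) 0 = a \<otimes> b"
  using cochains by auto

text \<open>The cochains describe products of constant series only. Each factor is split into its
  constant part and a remainder divisible by lambda, which contributes nothing to coefficient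
  0.\<close>

lemma mult_0:
  assumes f: "f \<in> carrier D" and g: "g \<in> carrier D"
  shows "(f \<star> g) 0 = f 0 \<otimes> g 0"
proof -
  have split: "h = (\<lambda>r. const_series A (h 0) r \<oplus> (h(0 := \<zero>)) r)" "h(0 := \<zero>) \<in> carrier D"
    if "h \<in> carrier D" for h
    using that by (auto simp: const_series_def fun_eq_iff D_carrier)
  have "(f \<star> g) 0 = (const_series A (f 0) \<star> g) 0 \<oplus> (f(0 := \<zero>) \<star> g) 0"
    using f g by (subst split(1)[OF f], subst D_l_distr) (simp_all add: split(2))
  also have "(f(0 := \<zero>) \<star> g) 0 = \<zero>"
    using mult_left_shift[OF split(2)[OF f] g, of 1 0] by simp
  also have "(const_series A (f 0) \<star> g) 0 =
      (const_series A (f 0) \<star> const_series A (g 0)) 0 \<oplus> (const_series A (f 0) \<star> g(0 := \<zero>)) 0"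
    using f g by (subst split(1)[OF g], subst D_r_distr) (simp_all add: split(2))
  also have "(const_series A (f 0) \<star> g(0 := \<zero>)) 0 = \<zero>"
    using mult_right_shift[OF const_series_closed split(2)[OF g], of "f 0" 1 0] f by simp
  finally show ?thesis
    using f g by (simp add: const_series_mult_0)
qed

lemma A_minus_closed [simp]: "a \<in> carrier A \<Longrightarrow> b \<in> carrier A \<Longrightarrow> a \<ominus> b \<in> carrier A"
  by (rule abelian_group.minus_closed[OF abelian_group_carrier])

lemma A_minus_add: "a \<in> carrier A \<Longrightarrow> b \<in> carrier A \<Longrightarrow> a \<ominus> b \<oplus> b = a"
  by (simp add: a_minus_def A_a_assoc abelian_group.l_neg[OF abelian_group_carrier]
      abelian_group.a_inv_closed[OF abelian_group_carrier])

lemma A_minus_eq_zero: "a \<in> carrier A \<Longrightarrow> a \<ominus> a = \<zero>"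
  by (simp add: a_minus_def abelian_group.r_neg[OF abelian_group_carrier])

text \<open>The difference of f and g is divisible by lambda^N, so coefficient N of its product with
  h is \<open>h 0\<close> times the N-th coefficient of the difference, and \<open>h 0\<close>
  vanishes. This is the gain of one order that \<open>coefficientwise_fixed_point\<close> asks
  for.\<close>

lemma mult_right_contraction:
  assumes "h \<in> carrier D" "h 0 = \<zero>" "f \<in> carrier D" "g \<in> carrier D" "\<forall>i<N. f i = g i"
  shows "(h \<star> f) N = (h \<star> g) N"
proof -
  define d where "d = (\<lambda>r. f r \<ominus> g r)"
  have d: "d \<in> carrier D" "\<forall>i<N. d i = \<zero>"
    using assms by (simp_all add: d_def D_carrier A_minus_eq_zero)
  have "(h \<star> d) N = \<zero>"
    using assms d mult_0[of h "\<lambda>r. d (r + N)"] divide_by_monomial(2)[OF d]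
    by (simp add: mult_right_shift)
  moreover have "f = (\<lambda>r. d r \<oplus> g r)"
    using assms by (simp add: d_def A_minus_add)
  then have "h \<star> f = (\<lambda>r. (h \<star> d) r \<oplus> (h \<star> g) r)"
    using D_r_distr[of h d g] assms d by simp
  ultimately show ?thesis
    using assms by simp
qed

lemma mult_left_contraction:
  assumes "h \<in> carrier D" "h 0 = \<zero>" "f \<in> carrier D" "g \<in> carrier D" "\<forall>i<N. f i = g i"
  shows "(f \<star> h) N = (g \<star> h) N"
proof -
  define d where "d = (\<lambda>r. f r \<ominus> g r)"
  have d: "d \<in> carrier D" "\<forall>i<N. d i = \<zero>"
    using assms by (simp_all add: d_def D_carrier A_minus_eq_zero)
  have "(d \<star> h) N = \<zero>"
    using assms d mult_0[of "\<lambda>r. d (r + N)" h] divide_by_monomial(2)[OF d]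
    by (simp add: mult_left_shift)
  moreover have "f = (\<lambda>r. d r \<oplus> g r)"
    using assms by (simp add: d_def A_minus_add)
  then have "f \<star> h = (\<lambda>r. (d \<star> h) r \<oplus> (g \<star> h) r)"
    using D_l_distr[of d g h] assms d by simp
  ultimately show ?thesis
    using assms by simp
qed

section \<open>Inverses and Hermitian square roots of formal series\<close>

abbreviation "one_D \<equiv> const_series A \<one>"

text \<open>With f = 1 + h, a right inverse is a fixed point of g \<mapsto> 1 - h \<star> g, a
  contraction since \<open>h 0\<close> vanishes.\<close>

lemma right_inverse_exists:
  assumes f: "f \<in> carrier D" and f0: "f 0 = \<one>"
  shows "\<exists>g\<in>carrier D. f \<star> g = one_D"
proof -
  define h where "h = (\<lambda>r. f r \<ominus> one_D r)"
  have one: "one_D \<in> carrier D"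
    by simp
  have h: "h \<in> carrier D"
    using f one by (simp add: h_def D_carrier)
  have h0: "h 0 = \<zero>"
    using f0 by (simp add: h_def const_series_def A_minus_eq_zero)
  define F where "F g = (\<lambda>r. one_D r \<ominus> (h \<star> g) r)" for g
  have carrier_eq: "Pi UNIV (\<lambda>_. carrier A) = carrier D"
    by (auto simp: D_carrier Pi_iff)
  obtain g where g: "g \<in> carrier D" "F g = g"
  proof (rule coefficientwise_fixed_point[of one_D "\<lambda>_. carrier A" F, unfolded carrier_eq])
    show "F f N = F g N" if "f \<in> carrier D" "g \<in> carrier D" "\<forall>i<N. f i = g i" for f g N
      using mult_right_contraction[OF h h0 that] by (simp add: F_def)
    show "F g \<in> carrier D" if "g \<in> carrier D" for g
      using D_mult_closed[OF h that] one unfolding F_def D_carrier by simp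
  qed (use one in blast)+
  have "f = (\<lambda>r. h r \<oplus> one_D r)"
    using D_entry[OF f] D_entry[OF one] by (simp add: h_def A_minus_add)
  then have "f \<star> g = (\<lambda>r. (h \<star> g) r \<oplus> (one_D \<star> g) r)"
    using D_l_distr[OF h one g(1)] by simp
  also have "\<dots> = (\<lambda>r. g r \<oplus> (h \<star> g) r)"
    using g h unit[OF g(1)] by (simp add: A_a_comm)
  also have "\<dots> = one_D"
  proof
    fix r
    have "g r = one_D r \<ominus> (h \<star> g) r"
      using fun_cong[OF g(2), of r] by (simp only: F_def)
    then show "g r \<oplus> (h \<star> g) r = one_D r"
      using A_minus_add[of "one_D r" "(h \<star> g) r"] D_entry[OF one] D_entry[OF D_mult_closed[OF h g(1)]]
      by simp
  qed
  finally show ?thesis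
    using g by blast
qed

text \<open>The right inverse g again has leading coefficient \<one>, hence a right inverse k of its
  own; associativity forces k = f, so g is two-sided.\<close>

lemma Units_D_of_leading_one:
  assumes f: "f \<in> carrier D" and f0: "f 0 = \<one>"
  shows "f \<in> Units D"
proof -
  obtain g where g: "g \<in> carrier D" "f \<star> g = one_D"
    using right_inverse_exists[OF assms] by blast
  have "\<one> \<otimes> g 0 = \<one>"
    using mult_0[OF f g(1)] g(2) f0 by (simp add: const_series_def)
  then have "g 0 = \<one>"
    using g by simp
  then obtain k where k: "k \<in> carrier D" "g \<star> k = one_D"
    using right_inverse_exists g by blast
  have "f = f \<star> (g \<star> k)"
    using k unit f by simp
  also have "\<dots> = k"
    using assoc[OF f g(1) k(1)] g k unit by simp
  finally show ?thesis
    using f g k by (auto simp: Units_def)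
qed

text \<open>The constant series of the inverted leading coefficient is only an approximate inverse.
  Multiplying by it on either side leads back to leading coefficient \<one>, which gives a right and
  a left inverse of f.\<close>

lemma Units_D_of_leading_unit:
  assumes f: "f \<in> carrier D" and f0: "f 0 \<in> Units A"
  shows "f \<in> Units D"
proof -
  define u where "u = const_series A (inv (f 0))"
  have u: "u \<in> carrier D"
    using f0 by (simp add: u_def)
  have "(f \<star> u) 0 = \<one>" "(u \<star> f) 0 = \<one>"
    using mult_0[OF f u] mult_0[OF u f] f0 by (simp_all add: u_def const_series_def)
  then have "f \<star> u \<in> Units D" "u \<star> f \<in> Units D"
    using f u by (simp_all add: Units_D_of_leading_one)
  then obtain x y where x: "x \<in> carrier D" "(f \<star> u) \<star> x = one_D"
    and y: "y \<in> carrier D" "y \<star> (u \<star> f) = one_D"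
    unfolding Units_def by auto
  have xr: "f \<star> (u \<star> x) = one_D" and yl: "(y \<star> u) \<star> f = one_D"
    using x y f u by (simp_all add: assoc)
  \<comment> \<open>The right inverse equals the left inverse.\<close>
  have "u \<star> x = ((y \<star> u) \<star> f) \<star> (u \<star> x)"
    using yl unit[of "u \<star> x"] u x by simp
  also have "\<dots> = (y \<star> u) \<star> (f \<star> (u \<star> x))"
    using u x y f by (intro assoc) simp_all
  also have "\<dots> = y \<star> u"
    using xr unit[of "y \<star> u"] u y by simp
  finally have "(u \<star> x) \<star> f = one_D"
    using yl by (simp only:)
  then show ?thesis
    using xr f D_mult_closed[OF u x(1)] unfolding Units_def D_simps by blast
qed

text \<open>For s = 1 + u, the equation s \<star> s = w becomes u = half (w - 1 - u \<star> u). The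
  right side is a contraction on series without constant term and preserves Hermitian series, as
  half is real and w Hermitian.\<close>

lemma hermitian_square_root:
  assumes rat: "contains_rationals TYPE('r)"
    and w: "w \<in> carrier D" "star D w = w" "w 0 = \<one>"
  shows "\<exists>s\<in>carrier D. star D s = s \<and> s 0 = \<one> \<and> s \<star> s = w"
proof -
  obtain h :: "rat \<Rightarrow> 'r" where h: "h 1 = 1" "\<And>p q. h (p + q) = h p + h q"
    using rat by (auto simp: contains_rationals_def)
  \<comment> \<open>The image of 1/2 under the embedding of the rationals; additivity alone makes it
    a half of 1.\<close>
  define half where "half = Cx (h (1/2)) 0"
  have half: "half + half = 1" "cx_cnj half = half"
    using h(2)[of "1/2" "1/2"] h(1) by (simp_all add: half_def plus_cx_def one_cx_def cx_cnj_def)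
  have halves: "half \<odot> a \<oplus> half \<odot> a = a" if "a \<in> carrier A" for a
    using smult_add_left[OF that, of half half] that by (simp add: half)
  have one: "one_D \<in> carrier D"
    by simp
  \<comment> \<open>Being Hermitian and having no constant term are conditions on single
    coefficients, so they can be built into the fixed point search and hold for the
    solution.\<close>
  define S where "S r = {a \<in> carrier A. star A a = a \<and> (r = 0 \<longrightarrow> a = \<zero>)}" for r :: nat
  have S: "u \<in> Pi UNIV S \<longleftrightarrow> u \<in> carrier D \<and> star D u = u \<and> u 0 = \<zero>" for u
    by (auto simp: S_def D_carrier fun_eq_iff Pi_iff)
  define F where "F u = (\<lambda>r. half \<odot> (w r \<ominus> one_D r \<ominus> (u \<star> u) r))" for u
  obtain u where "u \<in> Pi UNIV S" and Fu: "F u = u"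
  proof (rule coefficientwise_fixed_point)
    show "(\<lambda>r. \<zero>) \<in> Pi UNIV S"
      by (simp add: S_def)
    show "F u \<in> Pi UNIV S" if "u \<in> Pi UNIV S" for u
    proof -
      have u: "u \<in> carrier D" "star D u = u" "u 0 = \<zero>"
        using that by (simp_all only: S)
      have uu: "u \<star> u \<in> carrier D" "star A ((u \<star> u) r) = (u \<star> u) r" "(u \<star> u) 0 = \<zero>" for r
        using u mult_0[of u u] fun_cong[OF hermitian[OF u(1,1)], of r] by simp_all
      have w_star: "star A (w r) = w r" for r
        using fun_cong[OF w(2), of r] by simp
      have one_star: "star A (one_D r) = one_D r" for r
        by (simp add: const_series_def)
      have "star A (F u r) = F u r" for r
        using w(1) one uu w_star one_star
        by (simp add: F_def a_minus_def star_smult half star_add star_minus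
            abelian_group.a_inv_closed[OF abelian_group_carrier])
      moreover have "F u \<in> carrier D"
        using w(1) one uu(1) by (simp add: F_def D_carrier)
      moreover have "F u 0 = \<zero>"
        using w(3) uu(3) by (simp add: F_def const_series_def A_minus_eq_zero)
      ultimately show ?thesis
        by (simp add: S)
    qed
    show "F u N = F v N" if uv: "u \<in> Pi UNIV S" "v \<in> Pi UNIV S" "\<forall>i<N. u i = v i" for u v N
    proof -
      have u: "u \<in> carrier D" "u 0 = \<zero>" and v: "v \<in> carrier D" "v 0 = \<zero>"
        using uv(1,2) by (simp_all only: S)
      \<comment> \<open>The factors are exchanged one at a time, and each time the factor kept fixed
        has leading coefficient \<zero>.\<close>
      have "(u \<star> u) N = (u \<star> v) N"
        using u u(1) v(1) uv(3) by (rule mult_right_contraction)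
      also have "\<dots> = (v \<star> v) N"
        using v u(1) v(1) uv(3) by (rule mult_left_contraction)
      finally show ?thesis
        by (simp add: F_def)
    qed
  qed
  then have u: "u \<in> carrier D" "star D u = u" "u 0 = \<zero>"
    by (simp_all only: S)
  define s where "s = (\<lambda>r. one_D r \<oplus> u r)"
  have s: "s \<in> carrier D"
    using u one by (simp add: s_def D_carrier)
  have uu: "(u \<star> u) r \<in> carrier A" for r
    using u by simp
  have double: "u r \<oplus> u r = w r \<ominus> one_D r \<ominus> (u \<star> u) r" for r
  proof -
    have "u r = half \<odot> (w r \<ominus> one_D r \<ominus> (u \<star> u) r)"
      using fun_cong[OF Fu, of r] by (simp add: F_def)
    then show ?thesis
      using halves[of "w r \<ominus> one_D r \<ominus> (u \<star> u) r"] w(1) one uu by simp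
  qed
  have "s \<star> s = (\<lambda>r. s r \<oplus> (u \<star> s) r)"
    using D_l_distr[OF one u(1) s] unit[OF s] by (simp add: s_def)
  also have "u \<star> s = (\<lambda>r. u r \<oplus> (u \<star> u) r)"
    using D_r_distr[OF u(1) one u(1)] unit[OF u(1)] by (simp add: s_def)
  also have "(\<lambda>r. s r \<oplus> (u r \<oplus> (u \<star> u) r)) = (\<lambda>r. ((u r \<oplus> u r) \<oplus> (u \<star> u) r) \<oplus> one_D r)"
    using u(1) D_entry[OF one] uu by (simp add: s_def A_a_ac)
  also have "\<dots> = w"
    using w(1) D_entry[OF one] uu by (simp add: double A_minus_add)
  finally have "s \<star> s = w" .
  moreover have "s 0 = \<one>"
    using u by (simp add: s_def const_series_def)
  moreover have "star A (one_D r) = one_D r" "star A (u r) = u r" for r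
    using fun_cong[OF u(2), of r] by (simp_all add: const_series_def)
  then have "star D s = s"
    using u(1) D_entry[OF one] by (simp add: s_def star_add)
  ultimately show ?thesis
    using s by blast
qed

theorem strongly_full_deformation:
  fixes P :: "'n::finite \<Rightarrow> 'n \<Rightarrow> nat \<Rightarrow> 'a"
  assumes rat: "contains_rationals TYPE('r)"
    and P0: "strongly_full_projection A (\<lambda>i j. P i j 0)"
    and P: "projection (matrix_algebra D) P"
  shows "strongly_full_projection D P"
proof -
  obtain \<tau> where \<tau>: "\<tau> \<in> Units A" and trace: "matrix_trace A (\<lambda>i j. P i j 0) = inv (\<tau> \<otimes> star A \<tau>)"
    using P0 by (auto simp: strongly_full_projection_def)
  interpret PM: projection_module D P
    by unfold_locales (rule P)
  define t where "t = matrix_trace D P"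
  have t: "t \<in> carrier D"
    unfolding t_def matrix_trace_def by (rule D.sum_closed) (rule PM.P_closed)
  have t_star: "star D t = t"
    unfolding t_def matrix_trace_def
    by (subst D.sum_star) (simp_all only: PM.P_closed PM.star_P)
  have t_0: "t 0 = inv (\<tau> \<otimes> star A \<tau>)"
    unfolding trace[symmetric] t_def matrix_trace_def
    by (rule abelian_group.additive_map_finsum[OF D_abelian_group abelian_group_carrier, where h = "\<lambda>f. f 0"])
      (simp_all add: PM.P_closed)
  have \<tau>_closed: "\<tau> \<in> carrier A"
    using \<tau> by (rule monoid.Units_closed[OF monoid_carrier])
  define T where "T = const_series A \<tau>"
  have T: "T \<in> carrier D" "T 0 = \<tau>"
    using \<tau>_closed by (simp_all add: T_def) (simp add: const_series_def)
  \<comment> \<open>The constant lift of \<tau> is invertible for the deformed product, though its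
    inverse is in general not constant.\<close>
  have T_unit: "T \<in> Units D"
    using T \<tau> by (intro Units_D_of_leading_unit) simp_all
  have T': "star D T \<in> carrier D"
    using T(1) by (rule D.star_closed)
  \<comment> \<open>The order of the factors matches inv(\<tau> star(\<tau>)) = inv(star(\<tau>))
    inv(\<tau>): by \<open>mult_0\<close> everything cancels at order 0. It also makes w Hermitian
    along with t.\<close>
  define w where "w = star D T \<star> t \<star> T"
  have w: "w \<in> carrier D"
    using T T' t by (simp add: w_def del: D_simps)
  have "w 0 = star A \<tau> \<otimes> inv (\<tau> \<otimes> star A \<tau>) \<otimes> \<tau>"
    using T T' t mult_0[of "star D T \<star> t" T] mult_0[of "star D T" t] by (simp add: w_def t_0)
  also have "\<dots> = (star A \<tau> \<otimes> inv (star A \<tau>)) \<otimes> (inv \<tau> \<otimes> \<tau>)"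
    using \<tau> \<tau>_closed star_Units[OF \<tau>]
    by (simp add: monoid.inv_mult_Units[OF monoid_carrier] A_assoc del: monoid.Units_r_inv monoid.Units_l_inv)
  also have "\<dots> = \<one>"
    using \<tau> star_Units[OF \<tau>] by simp
  finally have w_0: "w 0 = \<one>" .
  have w_star: "star D w = w"
    using T T' t hermitian[of "star D T \<star> t" T] hermitian[of "star D T" t] D.star_star[OF T(1)] t_star assoc
    by (simp add: w_def del: D_simps)
  obtain s where s: "s \<in> carrier D" "star D s = s" "s 0 = \<one>" "s \<star> s = w"
    using hermitian_square_root[OF rat w w_star w_0] by blast
  have "s \<in> Units D"
    using s by (intro Units_D_of_leading_one)
  then have "\<exists>\<tau>\<in>Units D. t = inv\<^bsub>D\<^esub> (\<tau> \<otimes>\<^bsub>D\<^esub> star D \<tau>)"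
    using T_unit s t by (intro D.inverse_square_of_root[of T s t]) (simp_all add: w_def)
  with P show ?thesis
    by (simp add: strongly_full_projection_def t_def)
qed

end

theorem proposition4p3:
  fixes A :: "('r::linordered_idom cx, 'a) star_alg"
    and m :: "(nat \<Rightarrow> 'a) \<Rightarrow> (nat \<Rightarrow> 'a) \<Rightarrow> nat \<Rightarrow> 'a"
    and P0 :: "'n::finite \<Rightarrow> 'n \<Rightarrow> 'a"
    and P :: "'n \<Rightarrow> 'n \<Rightarrow> nat \<Rightarrow> 'a"
  assumes "contains_rationals TYPE('r)"
    and "star_algebra A"
    and "hermitian_deformation A m"
    and "strongly_full_projection A P0"
    and "projection (matrix_algebra (deformed_algebra A m)) P"
    and "\<And>i j. P i j 0 = P0 i j"
  shows "let \<A> = deformed_algebra A m;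
             E = projective_bimodule \<A> P;
             B = End_algebra \<A> E
         in strongly_full_projection \<A> P
            \<and> star_iso (corner_algebra (matrix_algebra \<A>) P) B
                 (\<lambda>L. \<lambda>x\<in>carrier E. matrix_vector \<A> L x)
            \<and> equivalence_bimodule B \<A> E TYPE('h)
            \<and> nondegenerate B \<A> E
            \<and> formally_Morita_equivalent B \<A> TYPE('n \<Rightarrow> nat \<Rightarrow> 'a) TYPE('h)"
proof -
  interpret hermitian_deformation A m by fact
  have full: "strongly_full_projection D P"
    using assms(1,4,5,6) by (intro strongly_full_deformation) simp_all
  then obtain \<tau> where \<tau>: "\<tau> \<in> Units D" "matrix_trace D P = inv\<^bsub>D\<^esub> (\<tau> \<otimes>\<^bsub>D\<^esub> star D \<tau>)"
    unfolding strongly_full_projection_def by blast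
  \<comment> \<open>\<open>D\<close> is a star algebra over R[[lambda]](i), and R[[lambda]] is again
    an ordered ring, so the results on strongly full projections apply to it as they stand.\<close>
  interpret PM: strongly_full_module D P \<tau>
    by unfold_locales (fact assms(5) \<tau>)+
  have equivalence: "equivalence_bimodule PM.B D PM.E TYPE('h)"
    by (rule PM.E_equivalence_bimodule)
  then have "formally_Morita_equivalent PM.B D TYPE('n \<Rightarrow> nat \<Rightarrow> 'a) TYPE('h)"
    unfolding formally_Morita_equivalent_def by blast
  with full equivalence PM.star_iso_operator_of PM.E_nondegenerate show ?thesis
    unfolding Let_def by blast
qed

end
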